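(* Let $Q$ be a quasiorder, let $X$ be a countably based $T_0$-space and let $\mathcal{L}(X)$ be its Borel base. Then for every $u\in\mathbb{T}_\sigma$ the level $\mathcal{L}^1(X,u)$ has a principal total representation. If $X$ is zero-dimensional, then for every $u\in\mathbb{T}_\sigma$ the level $\mathcal{L}(X,u)$ has a principal total representation.
   Context: Trees. $\omega^*$ is the set of finite strings over $\omega$, $\varepsilon$ the empty string, $\sqsubseteq$ the prefix order. A tree is a non-empty prefix-closed $T\subseteq\omega^*$; it is well founded if it has no infinite path, and infinite-branching if every non-leaf $\tau\in T$ has $\tau i\in T$ for all $i<\omega$. Terms. For a quasiorder $Q$, $\mathbb{T}_\sigma$ is the set of variable-free terms defined inductively from constants $q\in Q$, unary symbols $s_\alpha$ ($\alpha<\omega_1$) and $\omega$-ary symbols $F_q$ ($q\in Q$) and $F_\alpha$ ($\alpha<\omega_1$), all symbols being distinct. To each $u\in\mathbb{T}_\sigma$ one associates an infinite-branching well founded tree $T$ with a labeling $t$ of its nodes by terms, written $T(u)=(T,t)$: $T(q)$ and $T(s_\alpha(u))$ are the one-node tree $\{\varepsilon\}$ labeled by $q$, resp. by $s_\alpha(u)$; $T(F_q(u_0,u_1,\ldots))$ has root labeled $q$, and its labeled subtree above the node $i$ is $T(u_i)$ for each $i\ge0$; $T(F_\alpha(u_0,u_1,\ldots))$ has root labeled $s_\alpha(u_0)$, and its labeled subtree above the node $i$ is $T(u_{i+1})$ for each $i\ge0$. Bases. A base in a set $X$ is a sequence $\mathcal{L}(X)=\{\mathcal{L}_\alpha(X)\}_{\alpha<\omega_1}$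 of subsets of $P(X)$, each closed under countable unions and finite intersections, such that for $\alpha<\beta$ all sets of $\mathcal{L}_\alpha$ and their complements belong to $\mathcal{L}_\beta$. The $\beta$-shift is the base $\mathcal{L}^\beta(X)=\{\mathcal{L}_{\beta+\alpha}(X)\}_{\alpha<\omega_1}$; for $U\subseteq X$, the $U$-restriction $\mathcal{L}(U)$ is the base in $U$ with levels $\{U\cap S\mid S\in\mathcal{L}_\alpha(X)\}$. The Borel base in a space $X$ is $\{\mathbf{\Sigma}^0_{1+\alpha}(X)\}_{\alpha<\omega_1}$, where $\mathbf{\Sigma}^0_1$ is the class of open sets, $\mathbf{\Sigma}^0_2$ the class of countable unions of differences of open sets, and, for $\alpha>2$, $\mathbf{\Sigma}^0_\alpha$ the class of countable unions of complements of sets in $\bigcup_{\beta<\alpha}\mathbf{\Sigma}^0_\beta$. Families. For a well founded tree $T$, a $T$-family $\{U_\tau\}_{\tau\in T}$ of subsets of $X$ is monotone if $U_\tau\supseteq U_{\tau'}$ whenever $\tau\sqsubseteq\tau'$ in $T$; its components are $\tilde U_\tau=U_\tau\setminus\bigcup\{U_{\tau'}\mid\tau\sqsubset\tau'\in T\}$. The notions "$F$ is a $u$-family in $\mathcal{L}(X)$" and "$F$ determines $A:X\to Q$" are defined by induction, simultaneously for all bases: (i) the only $q$-family is $\{X\}$, and it determines exactly the constant function $\lambda x.q$; (ii) an $s_\alpha(u)$-family in $\mathcal{L}(X)$ is a $u$-family in $\mathcal{L}^{\omega^\alpha}(X)$, and it determines $A$ iff it determines $A$ as a $u$-family in $\mathcal{L}^{\omega^\alpha}(X)$;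 (iii) if $u=F_q(u_0,\ldots)$ or $u=F_\alpha(u_0,\ldots)$ and $T(u)=(T,t)$, a $u$-family is a pair $(\{U_\tau\}_{\tau\in T},\{F_\tau\}_{\tau\in T})$ where $\{U_\tau\}$ is a monotone $T$-family of $\mathcal{L}_0(X)$-sets with $U_\varepsilon=X$ and each $F_\tau$ is a $t(\tau)$-family in $\mathcal{L}(\tilde U_\tau)$; it determines $A$ iff $F_\tau$ determines $A|_{\tilde U_\tau}$ for every $\tau\in T$. $\mathcal{L}(X,u)$ is the set of all $A:X\to Q$ determined by some $u$-family in $\mathcal{L}(X)$; $\mathcal{L}^1(X,u)$ is the analogous set for the base $\mathcal{L}^1(X)$. Principal total representations. $\mathcal{N}=\omega^\omega$ is the Baire space. A family of $Q$-partition classes is a family $\{\mathbf{\Gamma}(X)\}_X$ indexed by countably based $T_0$-spaces with $\mathbf{\Gamma}(X)\subseteq Q^X$ and $A\circ f\in\mathbf{\Gamma}(X)$ for all continuous $f:X\to Y$ and $A\in\mathbf{\Gamma}(Y)$; for each $u$, $\{\mathcal{L}(X,u)\}_X$ and $\{\mathcal{L}^1(X,u)\}_X$ are such families. A function $\nu:\mathcal{N}\to\mathbf{\Gamma}(X)$ is a $\mathbf{\Gamma}$-TR if the function $(a,x)\mapsto\nu(a)(x)$ is in $\mathbf{\Gamma}(\mathcal{N}\times X)$. A principal total representation of $\mathbf{\Gamma}(X)$ is a $\mathbf{\Gamma}$-TR $\nu$ such that every $\mathbf{\Gamma}$-TR $\mu:\mathcal{N}\to\mathbf{\Gamma}(X)$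 is reducible to $\nu$, i.e. $\mu=\nu\circ f$ for some continuous $f:\mathcal{N}\to\mathcal{N}$ (such $\nu$ is automatically surjective). A space is zero-dimensional if it has a basis of clopen sets. *)

theory Defs
  imports "HOL-Analysis.Analysis" "HOL-Library.Sublist" "HOL-Library.Countable_Set_Type"
begin

section \<open>Countable ordinals\<close>

text \<open>The initial ordinal \<open>\<omega>\<^sub>1\<close>, realised as the cardinal successor of the order of the
  natural numbers. Ordinal arithmetic is given by the usual transfinite recursions, with
  suprema expressed as least upper bounds; these exist since countable sets are bounded.\<close>

typedef omega1 = "Field (cardSuc natLeq)"
  using Field_cardSuc_not_empty[OF natLeq_Card_order] by blast

instantiation omega1 :: ord
begin

definition less_eq_omega1 :: "omega1 \<Rightarrow> omega1 \<Rightarrow> bool" where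
  "a \<le> b \<longleftrightarrow> (Rep_omega1 a, Rep_omega1 b) \<in> cardSuc natLeq"

definition less_omega1 :: "omega1 \<Rightarrow> omega1 \<Rightarrow> bool" where
  "(a :: omega1) < b \<longleftrightarrow> a \<le> b \<and> a \<noteq> b"

instance ..

end

instance omega1 :: wellorder
proof -
  let ?r = "cardSuc natLeq"
  have wo: "Well_order ?r"
    by (rule cardSuc_Well_order[OF natLeq_Card_order])
  have refl: "refl_on (Field ?r) ?r" and tr: "trans ?r" and as: "antisym ?r"
    and tot: "total_on (Field ?r) ?r" and wf: "wf (?r - Id)"
    using wo by (auto simp: well_order_on_def linear_order_on_def partial_order_on_def
      preorder_on_def)
  have wf': "wf {(x, y :: omega1). x < y}"
    by (rule wf_subset[OF wf_inv_image[OF wf, of Rep_omega1]])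
      (auto simp: inv_image_def less_omega1_def less_eq_omega1_def Rep_omega1_inject)
  have anti: "x = y" if "x \<le> y" "y \<le> x" for x y :: omega1
    using antisymD[OF as, of "Rep_omega1 x" "Rep_omega1 y"] that
    by (simp add: less_eq_omega1_def Rep_omega1_inject)
  show "OFCLASS(omega1, wellorder_class)"
  proof
    fix x y z :: omega1
    show "x \<le> x"
      using refl Rep_omega1[of x] by (auto simp: less_eq_omega1_def refl_on_def)
    show "x \<le> z" if "x \<le> y" "y \<le> z"
      using that tr by (auto simp: less_eq_omega1_def dest: transD)
    show "x = y" if "x \<le> y" "y \<le> x"
      using that by (rule anti)
    show "x < y \<longleftrightarrow> x \<le> y \<and> \<not> y \<le> x"
      using anti[of x y] by (auto simp: less_omega1_def)
    show "x \<le> y \<or> y \<le> x"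
      using tot refl Rep_omega1[of x] Rep_omega1[of y]
      by (cases "x = y") (auto simp: less_eq_omega1_def total_on_def refl_on_def Rep_omega1_inject)
  next
    fix P :: "omega1 \<Rightarrow> bool" and a :: omega1
    assume "\<And>x. (\<And>y. y < x \<Longrightarrow> P y) \<Longrightarrow> P x"
    then show "P a"
      by (rule wf_induct_rule[OF wf', of P]) auto
  qed
qed

instantiation omega1 :: "{zero, one}"
begin

definition zero_omega1 :: omega1 where
  "0 = (LEAST a :: omega1. True)"

definition one_omega1 :: omega1 where
  "1 = (LEAST a :: omega1. 0 < a)"

instance ..

end

definition osucc :: "omega1 \<Rightarrow> omega1" where
  "osucc a = (LEAST b. a < b)"

definition omega :: omega1 where
  "omega = (LEAST a. infinite {..<a})"

function oadd :: "omega1 \<Rightarrow> omega1 \<Rightarrow> omega1" where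
  "oadd a b = (LEAST c. a \<le> c \<and> (\<forall>b'\<in>{..<b}. oadd a b' < c))"
  by auto
termination
  by (relation "inv_image {(x, y). x < y} snd") (auto intro: wf)

declare oadd.simps [simp del]

function omul :: "omega1 \<Rightarrow> omega1 \<Rightarrow> omega1" where
  "omul a b = (LEAST c. \<forall>b'\<in>{..<b}. oadd (omul a b') a \<le> c)"
  by auto
termination
  by (relation "inv_image {(x, y). x < y} snd") (auto intro: wf)

declare omul.simps [simp del]

function omega_pow :: "omega1 \<Rightarrow> omega1" where
  "omega_pow a = (LEAST c. 1 \<le> c \<and> (\<forall>a'\<in>{..<a}. omul (omega_pow a') omega \<le> c))"
  by auto
termination
  by (relation "{(x, y). x < y}") (auto intro: wf)

declare omega_pow.simps [simp del]

lemma countable_lessThan_omega1: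
  includes cardinal_syntax
  shows "countable {..<a :: omega1}"
proof -
  let ?r = "cardSuc natLeq"
  have co: "Card_order ?r"
    by (rule cardSuc_Card_order[OF natLeq_Card_order])
  have "|underS ?r (Rep_omega1 a)| <o ?r"
    by (rule card_of_underS[OF co Rep_omega1])
  then have "|underS ?r (Rep_omega1 a)| \<le>o natLeq"
    using cardSuc_ordLeq_ordLess[OF natLeq_Card_order card_of_Card_order] by blast
  then have "countable (underS ?r (Rep_omega1 a))"
    by (simp add: countable_card_le_natLeq)
  moreover have "Rep_omega1 ` {..<a} \<subseteq> underS ?r (Rep_omega1 a)"
    by (auto simp: underS_def less_omega1_def less_eq_omega1_def Rep_omega1_inject)
  ultimately have "countable (Rep_omega1 ` {..<a})"
    using countable_subset by blast
  then show ?thesis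
    by (rule countable_image_inj_on) (auto simp: inj_on_def Rep_omega1_inject)
qed

lemma uncountable_omega1:
  includes cardinal_syntax
  shows "uncountable (UNIV :: omega1 set)"
proof
  let ?r = "cardSuc natLeq"
  assume "countable (UNIV :: omega1 set)"
  then have "countable (Rep_omega1 ` (UNIV :: omega1 set))"
    by simp
  then have "countable (Field ?r)"
    using type_definition.Rep_range[OF type_definition_omega1] by simp
  then have "|Field ?r| \<le>o natLeq"
    by (simp add: countable_card_le_natLeq)
  moreover have "|Field ?r| =o ?r"
    by (rule card_of_Field_ordIso[OF cardSuc_Card_order[OF natLeq_Card_order]])
  ultimately have "?r \<le>o natLeq"
    using ordIso_ordLeq_trans ordIso_symmetric by blast
  then show False
    using cardSuc_greater[OF natLeq_Card_order] not_ordLess_ordLeq by blast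
qed

lemma bounded_countable_omega1:
  assumes "countable (A :: omega1 set)"
  shows "\<exists>b. \<forall>a\<in>A. a < b"
proof (rule ccontr)
  assume "\<not> ?thesis"
  then have "UNIV = (\<Union>a\<in>A. insert a {..<a})"
    by (auto simp: not_less) (metis order.not_eq_order_implies_strict)
  moreover have "countable (\<Union>a\<in>A. insert a {..<a})"
    using assms countable_lessThan_omega1 by auto
  ultimately show False
    using uncountable_omega1 by simp
qed


section \<open>Terms and their labeled trees\<close>

datatype 'q sterm =
    Const 'q
  | Shift omega1 "'q sterm"            \<comment> \<open>\<open>s\<^sub>\<alpha>\<close>\<close>
  | FQ 'q "nat \<Rightarrow> 'q sterm"            \<comment> \<open>\<open>F\<^sub>q\<close>\<close>
  | FO omega1 "nat \<Rightarrow> 'q sterm"        \<comment> \<open>\<open>F\<^sub>\<alpha>\<close>\<close>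

primrec tree :: "'q sterm \<Rightarrow> nat list set" where
  "tree (Const q) = {[]}"
| "tree (Shift \<alpha> u) = {[]}"
| "tree (FQ q us) = insert [] (\<Union>i. (#) i ` tree (us i))"
| "tree (FO \<alpha> us) = insert [] (\<Union>i. (#) i ` tree (us (Suc i)))"

text \<open>Only the values of the labeling on the nodes of the tree are meaningful.\<close>

primrec label :: "'q sterm \<Rightarrow> nat list \<Rightarrow> 'q sterm" where
  "label (Const q) = (\<lambda>\<tau>. Const q)"
| "label (Shift \<alpha> u) = (\<lambda>\<tau>. Shift \<alpha> u)"
| "label (FQ q us) = (\<lambda>\<tau>. case \<tau> of [] \<Rightarrow> Const q | i # \<tau>' \<Rightarrow> label (us i) \<tau>')"
| "label (FO \<alpha> us) =
    (\<lambda>\<tau>. case \<tau> of [] \<Rightarrow> Shift \<alpha> (us 0) | i # \<tau>' \<Rightarrow> label (us (Suc i)) \<tau>')"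


section \<open>Bases\<close>

type_synonym 'x base = "omega1 \<Rightarrow> 'x set set"

definition shift_base :: "omega1 \<Rightarrow> 'x base \<Rightarrow> 'x base" where
  "shift_base \<beta> L = (\<lambda>\<alpha>. L (oadd \<beta> \<alpha>))"

definition restrict_base :: "'x set \<Rightarrow> 'x base \<Rightarrow> 'x base" where
  "restrict_base U L = (\<lambda>\<alpha>. {U \<inter> S | S. S \<in> L \<alpha>})"

text \<open>The classes \<open>\<Sigma>\<^sup>0\<^sub>\<alpha>\<close> are indexed from \<open>1\<close>; putting the empty collection at index \<open>0\<close>
  makes the union over \<open>\<beta> < \<alpha>\<close> range over \<open>1 \<le> \<beta> < \<alpha>\<close>.\<close>

function Sigma0 :: "'x topology \<Rightarrow> omega1 \<Rightarrow> 'x set set" where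
  "Sigma0 X \<alpha> =
    (if \<alpha> = 0 then {}
     else if \<alpha> = 1 then {U. openin X U}
     else if \<alpha> = osucc 1 then
       {(\<Union>n::nat. U n - V n) | U V. \<forall>n. openin X (U n) \<and> openin X (V n)}
     else {(\<Union>n::nat. topspace X - B n) | B. \<forall>n. B n \<in> (\<Union>\<beta>\<in>{..<\<alpha>}. Sigma0 X \<beta>)})"
  by auto
termination
  by (relation "inv_image {(x, y). x < y} snd") (auto intro: wf)

declare Sigma0.simps [simp del]

definition borel_base :: "'x topology \<Rightarrow> 'x base" where
  "borel_base X = (\<lambda>\<alpha>. Sigma0 X (oadd 1 \<alpha>))"


section \<open>Families and the levels of the hierarchy\<close>

text \<open>A family for \<open>q\<close> is \<open>FLeaf X\<close>; a family for a term starting with \<open>F\<^sub>q\<close> or \<open>F\<^sub>\<alpha>\<close> is a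
  pair \<open>FNode U G\<close>, of which only the values on the tree of the term matter.\<close>

datatype 'x fam = FLeaf "'x set" | FNode "nat list \<Rightarrow> 'x set" "nat list \<Rightarrow> 'x fam"

definition monotone_family :: "nat list set \<Rightarrow> (nat list \<Rightarrow> 'x set) \<Rightarrow> bool" where
  "monotone_family T U \<longleftrightarrow> (\<forall>\<tau>\<in>T. \<forall>\<tau>'\<in>T. prefix \<tau> \<tau>' \<longrightarrow> U \<tau>' \<subseteq> U \<tau>)"

definition component :: "nat list set \<Rightarrow> (nat list \<Rightarrow> 'x set) \<Rightarrow> nat list \<Rightarrow> 'x set" where
  "component T U \<tau> = U \<tau> - \<Union>{U \<tau>' | \<tau>'. \<tau>' \<in> T \<and> strict_prefix \<tau> \<tau>'}"

definition is_F_term :: "'q sterm \<Rightarrow> bool" where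
  "is_F_term u \<longleftrightarrow> (\<exists>q us. u = FQ q us) \<or> (\<exists>\<alpha> us. u = FO \<alpha> us)"

text \<open>\<open>is_family u X L F\<close>: \<open>F\<close> is a \<open>u\<close>-family in the base \<open>L\<close> in the set \<open>X\<close>. Induction on
  derivations is used because the labels of a term need not be subterms of it.\<close>

inductive is_family :: "'q sterm \<Rightarrow> 'x set \<Rightarrow> 'x base \<Rightarrow> 'x fam \<Rightarrow> bool" where
  family_Const: "is_family (Const q) X L (FLeaf X)"
| family_Shift: "is_family u X (shift_base (omega_pow \<alpha>) L) F \<Longrightarrow> is_family (Shift \<alpha> u) X L F"
| family_F: "\<lbrakk>is_F_term u; monotone_family (tree u) U; \<forall>\<tau>\<in>tree u. U \<tau> \<in> L 0; U [] = X;
    \<forall>\<tau>\<in>tree u. is_family (label u \<tau>) (component (tree u) U \<tau>)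
      (restrict_base (component (tree u) U \<tau>) L) (G \<tau>)\<rbrakk>
    \<Longrightarrow> is_family u X L (FNode U G)"

text \<open>\<open>determines u X L F A\<close>: the \<open>u\<close>-family \<open>F\<close> in the base \<open>L\<close> in \<open>X\<close> determines the
  restriction of \<open>A\<close> to \<open>X\<close>. Only the values of \<open>A\<close> on \<open>X\<close> are relevant, so that \<open>A\<close> itself
  stands for its restrictions to the components.\<close>

inductive determines ::
  "'q sterm \<Rightarrow> 'x set \<Rightarrow> 'x base \<Rightarrow> 'x fam \<Rightarrow> ('x \<Rightarrow> 'q) \<Rightarrow> bool" where
  determines_Const: "\<forall>x\<in>X. A x = q \<Longrightarrow> determines (Const q) X L (FLeaf X) A"
| determines_Shift: "determines u X (shift_base (omega_pow \<alpha>) L) F A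
    \<Longrightarrow> determines (Shift \<alpha> u) X L F A"
| determines_F: "\<lbrakk>is_F_term u;
    \<forall>\<tau>\<in>tree u. determines (label u \<tau>) (component (tree u) U \<tau>)
      (restrict_base (component (tree u) U \<tau>) L) (G \<tau>) A\<rbrakk>
    \<Longrightarrow> determines u X L (FNode U G) A"

text \<open>Functions on a set \<open>X\<close> are represented by the extensional functions, so that equality
  of functions is equality on \<open>X\<close>.\<close>

definition level_in :: "'x set \<Rightarrow> 'x base \<Rightarrow> 'q sterm \<Rightarrow> ('x \<Rightarrow> 'q) set" where
  "level_in X L u = {A \<in> extensional X. \<exists>F. is_family u X L F \<and> determines u X L F A}"

definition level :: "'x topology \<Rightarrow> 'q sterm \<Rightarrow> ('x \<Rightarrow> 'q) set" where
  "level X u = level_in (topspace X) (borel_base X) u"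

definition level1 :: "'x topology \<Rightarrow> 'q sterm \<Rightarrow> ('x \<Rightarrow> 'q) set" where
  "level1 X u = level_in (topspace X) (shift_base 1 (borel_base X)) u"


section \<open>Principal total representations\<close>

definition baire_space :: "(nat \<Rightarrow> nat) topology" where
  "baire_space = product_topology (\<lambda>_. discrete_topology UNIV) UNIV"

text \<open>A family of partition classes enters only through its members \<open>\<Gamma>(X)\<close> and
  \<open>\<Gamma>(\<N> \<times> X)\<close>, which are the first two arguments below.\<close>

definition is_TR ::
  "('x \<Rightarrow> 'q) set \<Rightarrow> ((nat \<Rightarrow> nat) \<times> 'x \<Rightarrow> 'q) set \<Rightarrow> ((nat \<Rightarrow> nat) \<Rightarrow> 'x \<Rightarrow> 'q) \<Rightarrow> bool" where
  "is_TR \<Gamma>X \<Gamma>NX \<nu> \<longleftrightarrow> (\<forall>a. \<nu> a \<in> \<Gamma>X) \<and> (\<lambda>(a, x). \<nu> a x) \<in> \<Gamma>NX"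

definition is_principal_TR ::
  "('x \<Rightarrow> 'q) set \<Rightarrow> ((nat \<Rightarrow> nat) \<times> 'x \<Rightarrow> 'q) set \<Rightarrow> ((nat \<Rightarrow> nat) \<Rightarrow> 'x \<Rightarrow> 'q) \<Rightarrow> bool" where
  "is_principal_TR \<Gamma>X \<Gamma>NX \<nu> \<longleftrightarrow> is_TR \<Gamma>X \<Gamma>NX \<nu> \<and>
    (\<forall>\<mu>. is_TR \<Gamma>X \<Gamma>NX \<mu> \<longrightarrow> (\<exists>f. continuous_map baire_space baire_space f \<and> \<mu> = \<nu> \<circ> f))"

definition zero_dimensional :: "'x topology \<Rightarrow> bool" where
  "zero_dimensional X \<longleftrightarrow> (\<exists>\<B>. (\<forall>V\<in>\<B>. openin X V \<and> closedin X V) \<and>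
    (\<forall>U x. openin X U \<and> x \<in> U \<longrightarrow> (\<exists>V\<in>\<B>. x \<in> V \<and> V \<subseteq> U)))"

end

theory Submission
  imports Defs
begin

text \<open>
  A principal representation is a single function \<open>H\<close> on \<open>\<N> \<times> X\<close> that belongs to the level of
  \<open>u\<close> and from which every other function of that level on \<open>\<N> \<times> X\<close> arises by a continuous
  substitution \<open>(a, x) \<mapsto> (f a, x)\<close>; then \<open>\<nu> a = H (a, \<cdot>)\<close>, whose values lie in the level on
  \<open>X\<close> because levels are stable under continuous preimages. Such an \<open>H\<close> is built by recursion
  on \<open>u\<close>.

  The recursion is possible because the tree of a term can be unfolded one node at a time. A
  family for \<open>F\<^sub>q(u\<^sub>0, u\<^sub>1, \<dots>)\<close> amounts to sets \<open>U\<^sub>i\<close> of level \<open>0\<close> and families for the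
  \<open>u\<^sub>i\<close> on the \<open>U\<^sub>i\<close>, with the value \<open>q\<close> outside all \<open>U\<^sub>i\<close>; for \<open>F\<^sub>\<alpha>\<close> the function outside
  all \<open>U\<^sub>i\<close> is in a shifted level. This is the predicate \<open>in_level\<close>, and it agrees with the
  definition by labeled trees (\<open>determined_on_iff_in_level\<close>).

  For a term \<open>F\<^sub>q(u\<^sub>0, u\<^sub>1, \<dots>)\<close>, a point \<open>a\<close> of Baire space codes, for each \<open>i\<close>, a set \<open>V\<^sub>i\<close>
  through a universal set and a function in the level of \<open>u\<^sub>i\<close> through the recursion. The coded
  functions need not agree where the coded sets overlap, so an arbitrary code describes no
  function. The reduction property repairs this: the \<open>V\<^sub>i\<close>, taken as subsets of \<open>\<N> \<times> X\<close>,
  are shrunk to pairwise disjoint sets \<open>R\<^sub>i\<close> of the same class with the same union, and \<open>H\<close> uses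
  the \<open>i\<close>-th function on \<open>R\<^sub>i\<close>. When \<open>a\<close> codes an actual function the shrinking is harmless,
  since on each \<open>R\<^sub>i \<subseteq> V\<^sub>i\<close> the \<open>i\<close>-th function is correct (\<open>parametrizes_F_term\<close>).

  It remains to know that the classes \<open>\<Sigma>\<^sup>0\<^sub>\<alpha>\<close> on \<open>\<N> \<times> X\<close> have universal sets, which
  follows from a countable base of \<open>X\<close> by induction on \<open>\<alpha>\<close> (\<open>universal_set_Sigma0\<close>), and
  the reduction property (\<open>has_reduction_if_ambiguous_generated\<close>). Reduction holds as soon as each set of the
  class is a countable union of sets that are in the class together with their complements. This
  is so for \<open>\<alpha> > 1\<close> in every space, and for the open sets if there is a countable clopen
  base. This is why \<open>\<L>\<^sup>1\<close>, which starts at \<open>\<Sigma>\<^sup>0\<^sub>2\<close>, works for every countably based \<open>X\<close>,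
  and \<open>\<L>\<close> for the zero-dimensional ones.
\<close>

section \<open>Levels without trees\<close>

definition determined_on :: "'q sterm \<Rightarrow> 'x set \<Rightarrow> 'x base \<Rightarrow> ('x \<Rightarrow> 'q) \<Rightarrow> bool" where
  "determined_on u C L A \<longleftrightarrow>
    (\<exists>F. is_family u C (restrict_base C L) F \<and> determines u C (restrict_base C L) F A)"

lemma restrict_base_restrict_base:
  "D \<subseteq> C \<Longrightarrow> restrict_base D (restrict_base C L) = restrict_base D L"
  by (rule ext)
    (simp add: restrict_base_def Setcompr_eq_image image_image Int_assoc[symmetric] Int_absorb2)

lemma shift_base_restrict_base:
  "shift_base \<beta> (restrict_base C L) = restrict_base C (shift_base \<beta> L)"
  by (simp add: shift_base_def restrict_base_def)

lemma determined_on_Const: "determined_on (Const q) C L A \<longleftrightarrow> (\<forall>x\<in>C. A x = q)"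
  unfolding determined_on_def
  by (auto intro: is_family.intros determines.intros
      elim!: determines.cases[of "Const q"] is_family.cases[of "Const q"] simp: is_F_term_def)

lemma determined_on_Shift:
  "determined_on (Shift \<alpha> u) C L A \<longleftrightarrow> determined_on u C (shift_base (omega_pow \<alpha>) L) A"
  (is "?l \<longleftrightarrow> ?r")
proof
  assume ?l
  then obtain F where "is_family (Shift \<alpha> u) C (restrict_base C L) F"
      "determines (Shift \<alpha> u) C (restrict_base C L) F A"
    unfolding determined_on_def by blast
  then have "is_family u C (restrict_base C (shift_base (omega_pow \<alpha>) L)) F"
      "determines u C (restrict_base C (shift_base (omega_pow \<alpha>) L)) F A"
    by (auto elim!: determines.cases[of "Shift \<alpha> u"] is_family.cases[of "Shift \<alpha> u"]
        simp: is_F_term_def shift_base_restrict_base)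
  then show ?r
    unfolding determined_on_def by blast
next
  assume ?r
  then show ?l
    unfolding determined_on_def
    by (auto intro: is_family.intros determines.intros simp flip: shift_base_restrict_base)
qed

lemma component_subset: "component T U \<tau> \<subseteq> U \<tau>"
  by (auto simp: component_def)

lemma Nil_in_tree: "[] \<in> tree u"
  by (cases u) auto

lemma tree_not_F_term: "\<not> is_F_term u \<Longrightarrow> tree u = {[]} \<and> label u [] = u"
  by (cases u) (auto simp: is_F_term_def)

lemma component_singleton: "component {[]} U [] = U []"
  by (auto simp: component_def)

lemma monotone_familyD:
  "monotone_family T U \<Longrightarrow> \<tau> \<in> T \<Longrightarrow> \<tau>' \<in> T \<Longrightarrow> prefix \<tau> \<tau>' \<Longrightarrow> U \<tau>' \<subseteq> U \<tau>"
  by (simp add: monotone_family_def)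

lemma monotone_family_root: "monotone_family (tree u) U \<Longrightarrow> \<tau> \<in> tree u \<Longrightarrow> U \<tau> \<subseteq> U []"
  by (rule monotone_familyD[OF _ Nil_in_tree]) auto

text \<open>The defining clause for terms starting with \<open>F\<^sub>q\<close> or \<open>F\<^sub>\<alpha>\<close> holds for the other terms as
  well, because their tree is a single node labeled by the term itself. This uniformity lets the
  children of a node be treated alike whether or not they branch further.\<close>

lemma determined_on_iff_tree_family:
  assumes "C \<in> restrict_base C L 0"
  shows "determined_on w C L A \<longleftrightarrow>
    (\<exists>U. monotone_family (tree w) U \<and> (\<forall>\<tau>\<in>tree w. U \<tau> \<in> restrict_base C L 0) \<and> U [] = C \<and>
      (\<forall>\<tau>\<in>tree w. determined_on (label w \<tau>) (component (tree w) U \<tau>) L A))"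
    (is "?l \<longleftrightarrow> (\<exists>U. ?r U)")
proof (cases "is_F_term w")
  case False
  then have t: "tree w = {[]}" "label w [] = w"
    using tree_not_F_term by auto
  have "?l \<Longrightarrow> ?r (\<lambda>_. C)"
    using assms by (simp add: t monotone_family_def component_singleton)
  moreover have "?r U \<Longrightarrow> ?l" for U
    by (auto simp: t component_singleton)
  ultimately show ?thesis
    by blast
next
  case True
  have sub: "component (tree w) U \<tau> \<subseteq> C"
    if "monotone_family (tree w) U" "U [] = C" "\<tau> \<in> tree w" for U \<tau>
    using monotone_family_root[OF that(1,3)] component_subset[of "tree w" U \<tau>] that(2) by blast
  show ?thesis
  proof
    assume ?l
    then obtain F where F: "is_family w C (restrict_base C L) F"
        "determines w C (restrict_base C L) F A"
      unfolding determined_on_def by blast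
    from F(1) True obtain U G where UG: "F = FNode U G" "monotone_family (tree w) U"
        "\<forall>\<tau>\<in>tree w. U \<tau> \<in> restrict_base C L 0" "U [] = C"
        "\<forall>\<tau>\<in>tree w. is_family (label w \<tau>) (component (tree w) U \<tau>)
          (restrict_base (component (tree w) U \<tau>) (restrict_base C L)) (G \<tau>)"
      by (cases rule: is_family.cases) (auto simp: is_F_term_def)
    from F(2) True UG(1) have det: "\<forall>\<tau>\<in>tree w.
        determines (label w \<tau>) (component (tree w) U \<tau>)
          (restrict_base (component (tree w) U \<tau>) (restrict_base C L)) (G \<tau>) A"
      by (cases rule: determines.cases) (auto simp: is_F_term_def)
    have "determined_on (label w \<tau>) (component (tree w) U \<tau>) L A" if "\<tau> \<in> tree w" for \<tau>
      using bspec[OF UG(5) that] bspec[OF det that]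
      unfolding determined_on_def restrict_base_restrict_base[OF sub[OF UG(2,4) that]] by blast
    with UG show "\<exists>U. ?r U"
      by blast
  next
    assume "\<exists>U. ?r U"
    then obtain U where U: "?r U"
      by blast
    then obtain G where G: "\<forall>\<tau>\<in>tree w.
        is_family (label w \<tau>) (component (tree w) U \<tau>)
          (restrict_base (component (tree w) U \<tau>) L) (G \<tau>) \<and>
        determines (label w \<tau>) (component (tree w) U \<tau>)
          (restrict_base (component (tree w) U \<tau>) L) (G \<tau>) A"
      unfolding determined_on_def by metis
    have eq: "restrict_base (component (tree w) U \<tau>) (restrict_base C L) =
        restrict_base (component (tree w) U \<tau>) L" if "\<tau> \<in> tree w" for \<tau>
      using U that by (intro restrict_base_restrict_base sub) auto
    have "is_family w C (restrict_base C L) (FNode U G)"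
      using U True G eq by (intro is_family.intros) auto
    moreover have "determines w C (restrict_base C L) (FNode U G) A"
      using True G eq by (intro determines.intros) auto
    ultimately show ?l
      unfolding determined_on_def by blast
  qed
qed

text \<open>Cutting a labeled tree below its root. The component of a node other than the root depends
  only on the subtree through that node, and the component of the root is what the children of the
  root leave over, because the family is monotone. Conversely, families on the pieces \<open>C \<inter> U i\<close>
  are glued under a new root; they are families of sets in the base restricted to \<open>C\<close> because
  level \<open>0\<close> is closed under intersection. The terms \<open>w i\<close> are the children and \<open>r\<close> is the label
  of the root, so that both kinds of branching terms are covered.\<close>

lemma determined_on_F_term:
  fixes u :: "'q sterm" and w :: "nat \<Rightarrow> 'q sterm" and L :: "'x base"
  assumes tree_u: "tree u = insert [] (\<Union>i. (#) i ` tree (w i))"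
    and root: "label u [] = r" and child: "\<And>i \<tau>. label u (i # \<tau>) = label (w i) \<tau>"
    and Int: "\<And>S T. S \<in> L 0 \<Longrightarrow> T \<in> L 0 \<Longrightarrow> S \<inter> T \<in> L 0"
    and top: "Y \<in> L 0" "C \<subseteq> Y"
  shows "determined_on u C L A \<longleftrightarrow>
    (\<exists>U. (\<forall>i. U i \<in> L 0 \<and> determined_on (w i) (C \<inter> U i) L A) \<and>
      determined_on r (C - (\<Union>i. U i)) L A)"
proof -
  have child_in_tree: "i # \<tau> \<in> tree u" if "\<tau> \<in> tree (w i)" for i \<tau>
    using that by (auto simp: tree_u)
  have in_restrict: "D \<in> restrict_base D L 0" if "D \<subseteq> C" for D
    using that top by (auto simp: restrict_base_def)
  have comp_child: "component (tree u) V (i # \<tau>) = component (tree (w i)) (\<lambda>\<tau>. V (i # \<tau>)) \<tau>"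
    for V :: "nat list \<Rightarrow> 'x set" and i \<tau>
  proof -
    have "{V \<tau>' |\<tau>'. \<tau>' \<in> tree u \<and> strict_prefix (i # \<tau>) \<tau>'} =
        {V (i # \<tau>') |\<tau>'. \<tau>' \<in> tree (w i) \<and> strict_prefix \<tau> \<tau>'}"
    proof (intro subset_antisym subsetI)
      fix S assume "S \<in> {V (i # \<tau>') |\<tau>'. \<tau>' \<in> tree (w i) \<and> strict_prefix \<tau> \<tau>'}"
      then obtain \<tau>' where "S = V (i # \<tau>')" "\<tau>' \<in> tree (w i)" "strict_prefix \<tau> \<tau>'"
        by blast
      then show "S \<in> {V \<tau>' |\<tau>'. \<tau>' \<in> tree u \<and> strict_prefix (i # \<tau>) \<tau>'}"
        by (auto simp: tree_u intro!: exI[of _ "i # \<tau>'"])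
    qed (auto simp: tree_u)
    then show ?thesis
      by (simp add: component_def)
  qed
  have comp_root: "component (tree u) V [] = V [] - (\<Union>i. V [i])"
    if "monotone_family (tree u) V" for V :: "nat list \<Rightarrow> 'x set"
  proof -
    have child_sub: "V (i # \<tau>) \<subseteq> V [i]" if "\<tau> \<in> tree (w i)" for i \<tau>
      by (rule monotone_familyD[OF \<open>monotone_family (tree u) V\<close>])
        (use that in \<open>simp_all add: child_in_tree Nil_in_tree\<close>)
    have "\<Union>{V \<tau>' |\<tau>'. \<tau>' \<in> tree u \<and> strict_prefix [] \<tau>'} = (\<Union>i. V [i])"
    proof (intro subset_antisym subsetI)
      fix x assume "x \<in> \<Union>{V \<tau>' |\<tau>'. \<tau>' \<in> tree u \<and> strict_prefix [] \<tau>'}"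
      then show "x \<in> (\<Union>i. V [i])"
        using child_sub by (auto simp: tree_u)
    next
      fix x assume "x \<in> (\<Union>i. V [i])"
      then obtain i where "x \<in> V [i]"
        by blast
      moreover have "[i] \<in> tree u" "strict_prefix [] [i]"
        by (simp_all add: child_in_tree Nil_in_tree)
      ultimately show "x \<in> \<Union>{V \<tau>' |\<tau>'. \<tau>' \<in> tree u \<and> strict_prefix [] \<tau>'}"
        by blast
    qed
    then show ?thesis
      by (simp add: component_def)
  qed
  show ?thesis
  proof
    assume "determined_on u C L A"
    then obtain V where V: "monotone_family (tree u) V"
        "\<forall>\<tau>\<in>tree u. V \<tau> \<in> restrict_base C L 0" "V [] = C"
        "\<forall>\<tau>\<in>tree u. determined_on (label u \<tau>) (component (tree u) V \<tau>) L A"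
      using determined_on_iff_tree_family[OF in_restrict[OF order_refl]] by metis
    have "\<forall>i. \<exists>S. S \<in> L 0 \<and> V [i] = C \<inter> S"
      using bspec[OF V(2) child_in_tree[OF Nil_in_tree]] by (auto simp: restrict_base_def)
    then obtain U where U: "\<And>i. U i \<in> L 0" "\<And>i. V [i] = C \<inter> U i"
      by metis
    have "determined_on (w i) (C \<inter> U i) L A" for i
    proof -
      have mono: "monotone_family (tree (w i)) (\<lambda>\<tau>. V (i # \<tau>))"
        using monotone_familyD[OF V(1) child_in_tree child_in_tree]
        by (simp add: monotone_family_def)
      have "V (i # \<tau>) \<in> restrict_base (C \<inter> U i) L 0" if \<tau>: "\<tau> \<in> tree (w i)" for \<tau>
      proof -
        obtain S where S: "S \<in> L 0" "V (i # \<tau>) = C \<inter> S"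
          using V(2) child_in_tree[OF \<tau>] by (auto simp: restrict_base_def)
        have "V (i # \<tau>) \<subseteq> C \<inter> U i"
          using monotone_family_root[OF mono \<tau>] U(2) by simp
        with S have "V (i # \<tau>) = (C \<inter> U i) \<inter> S"
          by auto
        then show ?thesis
          using S(1) by (auto simp: restrict_base_def)
      qed
      moreover have "\<forall>\<tau>\<in>tree (w i).
          determined_on (label (w i) \<tau>) (component (tree (w i)) (\<lambda>\<tau>. V (i # \<tau>)) \<tau>) L A"
        using V(4) child_in_tree by (metis child comp_child)
      ultimately show ?thesis
        using mono U(2) top(2) in_restrict[of "C \<inter> U i"]
        by (subst determined_on_iff_tree_family) auto
    qed
    moreover have "determined_on r (C - (\<Union>i. U i)) L A"
    proof -
      have "component (tree u) V [] = C - (\<Union>i. U i)"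
        using comp_root[OF V(1)] V(3) U(2) by auto
      then show ?thesis
        using bspec[OF V(4) Nil_in_tree] root by simp
    qed
    ultimately show "\<exists>U. (\<forall>i. U i \<in> L 0 \<and> determined_on (w i) (C \<inter> U i) L A) \<and>
        determined_on r (C - (\<Union>i. U i)) L A"
      using U(1) by blast
  next
    assume "\<exists>U. (\<forall>i. U i \<in> L 0 \<and> determined_on (w i) (C \<inter> U i) L A) \<and>
      determined_on r (C - (\<Union>i. U i)) L A"
    then obtain U where U: "\<And>i. U i \<in> L 0" "\<And>i. determined_on (w i) (C \<inter> U i) L A"
        "determined_on r (C - (\<Union>i. U i)) L A"
      by blast
    have "\<forall>i. \<exists>V. monotone_family (tree (w i)) V \<and>
        (\<forall>\<tau>\<in>tree (w i). V \<tau> \<in> restrict_base (C \<inter> U i) L 0) \<and> V [] = C \<inter> U i \<and>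
        (\<forall>\<tau>\<in>tree (w i). determined_on (label (w i) \<tau>) (component (tree (w i)) V \<tau>) L A)"
      using U(2) top(2) in_restrict
      by (subst determined_on_iff_tree_family[symmetric]) auto
    then obtain V where V: "\<And>i. monotone_family (tree (w i)) (V i)"
        "\<And>i \<tau>. \<tau> \<in> tree (w i) \<Longrightarrow> V i \<tau> \<in> restrict_base (C \<inter> U i) L 0"
        "\<And>i. V i [] = C \<inter> U i"
        "\<And>i \<tau>. \<tau> \<in> tree (w i) \<Longrightarrow>
          determined_on (label (w i) \<tau>) (component (tree (w i)) (V i) \<tau>) L A"
      by metis
    define V' where "V' = (\<lambda>\<tau>. case \<tau> of [] \<Rightarrow> C | i # \<tau>' \<Rightarrow> V i \<tau>')"
    have V'_simps: "V' [] = C" "\<And>i \<tau>. V' (i # \<tau>) = V i \<tau>"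
      by (auto simp: V'_def)
    have V_sub: "V i \<tau> \<subseteq> C" if "\<tau> \<in> tree (w i)" for i \<tau>
      using monotone_family_root[OF V(1) that] V(3) by auto
    have mono: "monotone_family (tree u) V'"
      unfolding monotone_family_def
    proof (intro ballI impI)
      fix \<tau> \<tau>'
      assume \<tau>: "\<tau> \<in> tree u" "\<tau>' \<in> tree u" "prefix \<tau> \<tau>'"
      show "V' \<tau>' \<subseteq> V' \<tau>"
      proof (cases \<tau>)
        case Nil
        with \<tau>(2) show ?thesis
          using V_sub by (cases \<tau>') (auto simp: V'_simps tree_u)
      next
        case (Cons i \<rho>)
        with \<tau>(3) obtain \<rho>' where "\<tau>' = i # \<rho>'" "prefix \<rho> \<rho>'"
          by (cases \<tau>') auto
        with Cons \<tau>(1,2) show ?thesis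
          using monotone_familyD[OF V(1)[of i], of \<rho> \<rho>'] by (auto simp: V'_simps tree_u)
      qed
    qed
    have "V' \<tau> \<in> restrict_base C L 0" if "\<tau> \<in> tree u" for \<tau>
    proof (cases \<tau>)
      case Nil
      then show ?thesis
        using in_restrict[OF order_refl] by (simp add: V'_simps)
    next
      case (Cons i \<tau>')
      with that have "V i \<tau>' \<in> restrict_base (C \<inter> U i) L 0"
        by (auto simp: tree_u intro: V(2))
      then obtain S where "S \<in> L 0" "V i \<tau>' = C \<inter> (U i \<inter> S)"
        by (auto simp: restrict_base_def)
      then show ?thesis
        using Int[OF U(1)] Cons by (auto simp: restrict_base_def V'_simps)
    qed
    moreover have "determined_on (label u \<tau>) (component (tree u) V' \<tau>) L A" if "\<tau> \<in> tree u" for \<tau>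
    proof (cases \<tau>)
      case Nil
      have "component (tree u) V' [] = C - (\<Union>i. U i)"
        using comp_root[OF mono] by (auto simp: V'_simps V(3))
      then show ?thesis
        using U(3) root Nil by simp
    next
      case (Cons i \<tau>')
      with that have "\<tau>' \<in> tree (w i)"
        by (auto simp: tree_u)
      then show ?thesis
        using V(4) by (simp add: Cons child comp_child V'_simps)
    qed
    ultimately show "determined_on u C L A"
      using mono V'_simps(1) determined_on_iff_tree_family[OF in_restrict[OF order_refl]] by blast
  qed
qed

text \<open>The recursive form of the levels. All sets are taken from a base in the whole space and only
  the domain \<open>C\<close> of the function shrinks, so no restricted bases occur. The sets \<open>U i\<close> may
  overlap.\<close>

primrec in_level :: "'q sterm \<Rightarrow> 'x base \<Rightarrow> 'x set \<Rightarrow> ('x \<Rightarrow> 'q) \<Rightarrow> bool" where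
  "in_level (Const q) = (\<lambda>L C A. \<forall>x\<in>C. A x = q)"
| "in_level (Shift \<alpha> u) = (\<lambda>L. in_level u (shift_base (omega_pow \<alpha>) L))"
| "in_level (FQ q us) = (\<lambda>L C A. \<exists>U. (\<forall>i. U i \<in> L 0 \<and> in_level (us i) L (C \<inter> U i) A) \<and>
    (\<forall>x\<in>C - (\<Union>i. U i). A x = q))"
| "in_level (FO \<alpha> us) = (\<lambda>L C A. \<exists>U. (\<forall>i. U i \<in> L 0 \<and> in_level (us (Suc i)) L (C \<inter> U i) A) \<and>
    in_level (us 0) (shift_base (omega_pow \<alpha>) L) (C - (\<Union>i. U i)) A)"

lemma determined_on_iff_in_level:
  assumes "\<And>\<alpha> S T. S \<in> L \<alpha> \<Longrightarrow> T \<in> L \<alpha> \<Longrightarrow> S \<inter> T \<in> L \<alpha>" and "\<And>\<alpha>. Y \<in> L \<alpha>" and "C \<subseteq> Y"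
  shows "determined_on u C L A \<longleftrightarrow> in_level u L C A"
  using assms
proof (induction u arbitrary: L C)
  case (Const q)
  then show ?case
    by (simp add: determined_on_Const)
next
  case (Shift \<alpha> u)
  then show ?case
    by (simp add: determined_on_Shift shift_base_def)
next
  case (FQ q us)
  have "determined_on (us i) (C \<inter> U) L A \<longleftrightarrow> in_level (us i) L (C \<inter> U) A" for i U
    using FQ by (intro FQ.IH) auto
  then show ?case
    using FQ.prems determined_on_F_term[of "FQ q us" us "Const q" L Y C A]
    by (simp add: determined_on_Const)
next
  case (FO \<alpha> us)
  have "determined_on (us i) (C \<inter> U) L A \<longleftrightarrow> in_level (us i) L (C \<inter> U) A" for i U
    using FO.prems by (intro FO.IH) auto
  moreover have "determined_on (us 0) (C - U) (shift_base (omega_pow \<alpha>) L) A \<longleftrightarrow>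
      in_level (us 0) (shift_base (omega_pow \<alpha>) L) (C - U) A" for U
    using FO.prems by (intro FO.IH) (auto simp: shift_base_def)
  ultimately show ?case
    using FO.prems determined_on_F_term[of "FO \<alpha> us" "\<lambda>i. us (Suc i)" "Shift \<alpha> (us 0)" L Y C A]
    by (simp add: determined_on_Shift)
qed

text \<open>This covers restriction to a smaller domain, change of the function outside the domain,
  passage to sections and continuous substitution: \<open>h\<close> is the identity in the first two cases.\<close>

lemma in_level_preimage:
  assumes "\<And>\<alpha> S. S \<in> L \<alpha> \<Longrightarrow> h -` S \<inter> Y \<in> K \<alpha>"
    and "in_level u L C A"
    and "D \<subseteq> Y" and "\<And>x. x \<in> D \<Longrightarrow> h x \<in> C \<and> B x = A (h x)"
  shows "in_level u K D B"
  using assms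
proof (induction u arbitrary: L K C D)
  case (Const q)
  then show ?case
    by simp
next
  case (Shift \<alpha> u)
  have "in_level u (shift_base (omega_pow \<alpha>) K) D B"
    by (rule Shift.IH[where L = "shift_base (omega_pow \<alpha>) L" and C = C])
      (use Shift.prems in \<open>auto simp: shift_base_def\<close>)
  then show ?case
    by simp
next
  case (FQ q us)
  from FQ.prems(2) obtain U where U: "\<And>i. U i \<in> L 0" "\<And>i. in_level (us i) L (C \<inter> U i) A"
      "\<forall>x\<in>C - (\<Union>i. U i). A x = q"
    by auto
  have "in_level (us i) K (D \<inter> (h -` U i \<inter> Y)) B" for i
    by (rule FQ.IH[where L = L and C = "C \<inter> U i"]) (use FQ.prems U in auto)
  moreover have "B x = q" if "x \<in> D - (\<Union>i. h -` U i \<inter> Y)" for x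
    using that FQ.prems(3) FQ.prems(4)[of x] U(3) by auto
  ultimately show ?case
    using FQ.prems(1)[OF U(1)] unfolding in_level.simps
    by (intro exI[of _ "\<lambda>i. h -` U i \<inter> Y"]) simp
next
  case (FO \<alpha> us)
  from FO.prems(2) obtain U where U: "\<And>i. U i \<in> L 0"
      "\<And>i. in_level (us (Suc i)) L (C \<inter> U i) A"
      "in_level (us 0) (shift_base (omega_pow \<alpha>) L) (C - (\<Union>i. U i)) A"
    by auto
  have "in_level (us (Suc i)) K (D \<inter> (h -` U i \<inter> Y)) B" for i
    by (rule FO.IH[where L = L and C = "C \<inter> U i"]) (use FO.prems U in auto)
  moreover have "in_level (us 0) (shift_base (omega_pow \<alpha>) K) (D - (\<Union>i. h -` U i \<inter> Y)) B"
    by (rule FO.IH[where L = "shift_base (omega_pow \<alpha>) L" and C = "C - (\<Union>i. U i)"])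
      (use FO.prems U in \<open>auto simp: shift_base_def\<close>)
  ultimately show ?case
    using FO.prems(1)[OF U(1)] unfolding in_level.simps
    by (intro exI[of _ "\<lambda>i. h -` U i \<inter> Y"]) simp
qed

section \<open>Borel classes\<close>

lemma zero_le_omega1: "(0 :: omega1) \<le> a"
  unfolding zero_omega1_def by (rule Least_le) simp

lemma zero_less_one_omega1: "(0 :: omega1) < 1"
  unfolding one_omega1_def
  using bounded_countable_omega1[of "{0}"] by (auto intro: LeastI_ex)

lemma one_le_iff_omega1: "(1 :: omega1) \<le> a \<longleftrightarrow> 0 < a"
  using zero_less_one_omega1 by (auto simp: one_omega1_def intro: Least_le)

lemma less_osucc: "a < osucc a"
  unfolding osucc_def
  using bounded_countable_omega1[of "{a}"] by (auto intro: LeastI_ex)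

lemma osucc_le: "a < b \<Longrightarrow> osucc a \<le> b"
  unfolding osucc_def by (rule Least_le)

text \<open>The least element in the definition of the sum exists because countable sets are bounded.
  These two inequalities are all that is needed about ordinal sums.\<close>

lemma oadd_bounds: "a \<le> oadd a b" "c < b \<Longrightarrow> oadd a c < oadd a b"
proof -
  have "countable (insert a (oadd a ` {..<b}))"
    by (intro countable_insert countable_image countable_lessThan_omega1)
  from bounded_countable_omega1[OF this]
  have "\<exists>d. a \<le> d \<and> (\<forall>b'\<in>{..<b}. oadd a b' < d)"
    by (auto intro: less_imp_le)
  then have "a \<le> oadd a b \<and> (\<forall>b'\<in>{..<b}. oadd a b' < oadd a b)"
    by (subst (1 3) oadd.simps) (rule LeastI_ex)
  then show "a \<le> oadd a b" "c < b \<Longrightarrow> oadd a c < oadd a b"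
    by auto
qed

lemma Sigma0_0: "Sigma0 X 0 = {}"
  by (simp add: Sigma0.simps)

lemma Sigma0_pos: "S \<in> Sigma0 X \<alpha> \<Longrightarrow> 0 < \<alpha>"
  using zero_le_omega1[of \<alpha>] Sigma0_0[of X] by (metis empty_iff order.order_iff_strict)

lemma Sigma0_1: "Sigma0 X 1 = {U. openin X U}"
  using zero_less_one_omega1 by (subst Sigma0.simps) auto

lemma Sigma0_2:
  "Sigma0 X (osucc 1) = {(\<Union>n::nat. U n - V n) |U V. \<forall>n. openin X (U n) \<and> openin X (V n)}"
  using zero_less_one_omega1 less_osucc[of 1] by (subst Sigma0.simps) auto

lemma openin_Diff_in_Sigma0_2:
  assumes "openin X U" "openin X V"
  shows "U - V \<in> Sigma0 X (osucc 1)"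
  unfolding Sigma0_2
  by (rule CollectI, rule exI[of _ "\<lambda>_. U"], rule exI[of _ "\<lambda>_. V"]) (simp add: assms)

lemma Sigma0_above_2:
  assumes "osucc 1 < \<alpha>"
  shows "Sigma0 X \<alpha> =
    {(\<Union>n::nat. topspace X - B n) |B. \<forall>n. \<exists>\<beta>. 0 < \<beta> \<and> \<beta> < \<alpha> \<and> B n \<in> Sigma0 X \<beta>}"
proof -
  have "(\<forall>n. B n \<in> (\<Union>\<beta>\<in>{..<\<alpha>}. Sigma0 X \<beta>)) \<longleftrightarrow>
      (\<forall>n. \<exists>\<beta>. 0 < \<beta> \<and> \<beta> < \<alpha> \<and> B n \<in> Sigma0 X \<beta>)" for B :: "nat \<Rightarrow> 'a set"
    using Sigma0_pos by fastforce
  then show ?thesis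
    using assms zero_less_one_omega1 less_osucc[of 1] by (subst Sigma0.simps) auto
qed

lemma omega1_cases_from_1:
  assumes "(0 :: omega1) < \<alpha>"
  obtains "\<alpha> = 1" | "\<alpha> = osucc 1" | "osucc 1 < \<alpha>"
  using assms osucc_le[of 1 \<alpha>] one_le_iff_omega1[of \<alpha>] by (metis order.order_iff_strict)

lemma Sigma0_subset_topspace:
  assumes "S \<in> Sigma0 X \<alpha>"
  shows "S \<subseteq> topspace X"
  using Sigma0_pos[OF assms]
proof (cases rule: omega1_cases_from_1)
  case 1
  then show ?thesis
    using assms by (simp add: Sigma0_1 openin_subset)
next
  case 2
  then obtain U V where "S = (\<Union>n::nat. U n - V n)" "\<And>n. openin X (U n)"
    using assms by (auto simp: Sigma0_2)
  moreover from this(2) have "U n \<subseteq> topspace X" for n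
    by (rule openin_subset)
  ultimately show ?thesis
    by blast
next
  case 3
  then show ?thesis
    using assms by (auto simp: Sigma0_above_2)
qed

lemma Sigma0_Compl:
  assumes "S \<in> Sigma0 X \<beta>" "0 < \<beta>" "\<beta> < \<alpha>"
  shows "topspace X - S \<in> Sigma0 X \<alpha>"
proof -
  have "0 < \<alpha>" "1 < \<alpha>"
    using assms one_le_iff_omega1[of \<beta>] by auto
  then show ?thesis
  proof (cases rule: omega1_cases_from_1)
    assume \<alpha>: "\<alpha> = osucc 1"
    have "\<beta> = 1"
      using assms(2,3) osucc_le[of 1 \<beta>] one_le_iff_omega1[of \<beta>] unfolding \<alpha>
      by (metis leD order.order_iff_strict)
    with assms(1) have "openin X S"
      by (simp add: Sigma0_1)
    then show ?thesis
      using openin_Diff_in_Sigma0_2 \<alpha> by blast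
  next
    assume "osucc 1 < \<alpha>"
    then show ?thesis
      unfolding Sigma0_above_2[OF \<open>osucc 1 < \<alpha>\<close>] using assms
      by (intro CollectI exI[of _ "\<lambda>_. S"]) auto
  qed auto
qed

lemma UN_prod_decode: "(\<Union>n. \<Union>k. f n k) = (\<Union>m. case_prod f (prod_decode m))"
proof (intro subset_antisym subsetI)
  fix x assume "x \<in> (\<Union>n. \<Union>k. f n k)"
  then obtain n k where "x \<in> f n k"
    by blast
  then have "x \<in> case_prod f (prod_decode (prod_encode (n, k)))"
    by simp
  then show "x \<in> (\<Union>m. case_prod f (prod_decode m))"
    by (rule UN_I[OF UNIV_I])
qed (auto simp: case_prod_unfold)

lemma Sigma0_Union:
  assumes "\<And>n::nat. S n \<in> Sigma0 X \<alpha>"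
  shows "(\<Union>n. S n) \<in> Sigma0 X \<alpha>"
  using Sigma0_pos[OF assms]
proof (cases rule: omega1_cases_from_1)
  case 1
  then show ?thesis
    using assms by (auto simp: Sigma0_1)
next
  case 2
  have "\<forall>n. \<exists>U V. S n = (\<Union>k::nat. U k - V k) \<and> (\<forall>k. openin X (U k) \<and> openin X (V k))"
    using assms by (simp add: 2 Sigma0_2)
  then obtain U V where UV: "\<And>n. S n = (\<Union>k::nat. U n k - V n k)"
      "\<And>n k. openin X (U n k)" "\<And>n k. openin X (V n k)"
    by metis
  have "(\<Union>n. S n) = (\<Union>m. case_prod U (prod_decode m) - case_prod V (prod_decode m))"
    unfolding UV(1) UN_prod_decode by (simp add: case_prod_unfold)
  moreover have "openin X (case_prod U (prod_decode m))" "openin X (case_prod V (prod_decode m))"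
    for m using UV by (auto split: prod.splits)
  ultimately show ?thesis
    unfolding 2 Sigma0_2
    by (intro CollectI exI[of _ "\<lambda>m. case_prod U (prod_decode m)"]
        exI[of _ "\<lambda>m. case_prod V (prod_decode m)"]) auto
next
  case 3
  have "\<forall>n. \<exists>B. S n = (\<Union>k::nat. topspace X - B k) \<and>
      (\<forall>k. \<exists>\<beta>. 0 < \<beta> \<and> \<beta> < \<alpha> \<and> B k \<in> Sigma0 X \<beta>)"
    using assms by (simp add: Sigma0_above_2[OF 3])
  then obtain B where B: "\<And>n. S n = (\<Union>k::nat. topspace X - B n k)"
      "\<And>n k. \<exists>\<beta>. 0 < \<beta> \<and> \<beta> < \<alpha> \<and> B n k \<in> Sigma0 X \<beta>"
    by metis
  have "(\<Union>n. S n) = (\<Union>m. topspace X - case_prod B (prod_decode m))"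
    unfolding B(1) UN_prod_decode by (simp add: case_prod_unfold)
  moreover have "\<exists>\<beta>. 0 < \<beta> \<and> \<beta> < \<alpha> \<and> case_prod B (prod_decode m) \<in> Sigma0 X \<beta>" for m
    using B(2) by (auto split: prod.splits)
  ultimately show ?thesis
    unfolding Sigma0_above_2[OF 3]
    by (intro CollectI exI[of _ "\<lambda>m. case_prod B (prod_decode m)"]) auto
qed

lemma Sigma0_Union_countable:
  assumes "countable I" "I \<noteq> {}" "\<And>i. i \<in> I \<Longrightarrow> S i \<in> Sigma0 X \<alpha>"
  shows "(\<Union>i\<in>I. S i) \<in> Sigma0 X \<alpha>"
proof -
  have "(\<Union>i\<in>range (from_nat_into I). S i) \<in> Sigma0 X \<alpha>"
    unfolding image_image by (intro Sigma0_Union assms(3) from_nat_into[OF assms(2)])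
  then show ?thesis
    by (simp only: range_from_nat_into[OF assms(2,1)])
qed

lemma Sigma0_Un: "S \<in> Sigma0 X \<alpha> \<Longrightarrow> T \<in> Sigma0 X \<alpha> \<Longrightarrow> S \<union> T \<in> Sigma0 X \<alpha>"
  using Sigma0_Union_countable[of "{S, T}" id X \<alpha>] by auto

text \<open>From the definition by complements, monotonicity is immediate above index \<open>2\<close>. An open set
  is the complement of a difference of open sets, and such a difference is itself the complement of
  a \<open>\<Sigma>\<^sup>0\<^sub>2\<close> set; this handles the first two classes.\<close>

lemma Sigma0_mono:
  assumes "S \<in> Sigma0 X \<beta>" "0 < \<beta>" "\<beta> \<le> \<alpha>"
  shows "S \<in> Sigma0 X \<alpha>"
proof (cases "\<beta> = \<alpha>")
  case True
  then show ?thesis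
    using assms(1) by simp
next
  case False
  then have "\<beta> < \<alpha>"
    using assms(3) by simp
  from assms(2) show ?thesis
  proof (cases rule: omega1_cases_from_1)
    case 1
    then have S: "openin X S"
      using assms(1) by (simp add: Sigma0_1)
    have two: "0 < osucc 1"
      using zero_less_one_omega1 less_osucc[of 1] by (rule less_trans)
    consider "\<alpha> = osucc 1" | "osucc 1 < \<alpha>"
      using osucc_le[of 1 \<alpha>] \<open>\<beta> < \<alpha>\<close> 1 by (metis order.order_iff_strict)
    then show ?thesis
    proof cases
      case 1
      then show ?thesis
        using openin_Diff_in_Sigma0_2[OF S openin_empty] by simp
    next
      case 2
      have "topspace X - S \<in> Sigma0 X (osucc 1)"
        using Sigma0_Compl[OF assms(1,2)] less_osucc[of 1] \<open>\<beta> = 1\<close> by simp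
      then have "topspace X - (topspace X - S) \<in> Sigma0 X \<alpha>"
        using Sigma0_Compl[OF _ two 2] by blast
      then show ?thesis
        using openin_subset[OF S] by (simp add: Diff_Diff_Int Int_absorb1)
    qed
  next
    case 2
    then obtain U V where S: "S = (\<Union>n::nat. U n - V n)" and
        UV: "\<And>n. openin X (U n)" "\<And>n. openin X (V n)"
      using assms(1) by (auto simp: Sigma0_2)
    have "U n - V n \<in> Sigma0 X \<alpha>" for n
    proof -
      have "topspace X - U n \<in> Sigma0 X (osucc 1)"
        using UV by (intro Sigma0_Compl[of _ _ 1] zero_less_one_omega1 less_osucc)
          (auto simp: Sigma0_1)
      moreover have "V n \<in> Sigma0 X (osucc 1)"
        using openin_Diff_in_Sigma0_2[OF UV(2) openin_empty] by simp
      ultimately have "topspace X - ((topspace X - U n) \<union> V n) \<in> Sigma0 X \<alpha>"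
        using Sigma0_Compl[OF Sigma0_Un, of _ X \<beta>] assms(2) \<open>\<beta> < \<alpha>\<close> 2 by blast
      moreover have "topspace X - ((topspace X - U n) \<union> V n) = U n - V n"
        using openin_subset[OF UV(1)] by auto
      ultimately show ?thesis
        by simp
    qed
    then show ?thesis
      unfolding S by (rule Sigma0_Union)
  next
    case 3
    then obtain B where S: "S = (\<Union>n::nat. topspace X - B n)" and
        B: "\<And>n. \<exists>\<gamma>. 0 < \<gamma> \<and> \<gamma> < \<beta> \<and> B n \<in> Sigma0 X \<gamma>"
      using assms(1) by (auto simp: Sigma0_above_2)
    have "topspace X - B n \<in> Sigma0 X \<alpha>" for n
      using B[of n] \<open>\<beta> < \<alpha>\<close> by (auto intro: Sigma0_Compl less_trans)
    then show ?thesis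
      unfolding S by (rule Sigma0_Union)
  qed
qed

lemma openin_Sigma0: "openin X S \<Longrightarrow> 0 < \<alpha> \<Longrightarrow> S \<in> Sigma0 X \<alpha>"
  by (rule Sigma0_mono[of _ _ 1]) (auto simp: Sigma0_1 zero_less_one_omega1 one_le_iff_omega1)

lemma Sigma0_Int:
  assumes "S \<in> Sigma0 X \<alpha>" "T \<in> Sigma0 X \<alpha>"
  shows "S \<inter> T \<in> Sigma0 X \<alpha>"
  using Sigma0_pos[OF assms(1)]
proof (cases rule: omega1_cases_from_1)
  case 1
  then show ?thesis
    using assms by (auto simp: Sigma0_1)
next
  case 2
  obtain U V U' V' where S: "S = (\<Union>n::nat. U n - V n)" "T = (\<Union>n::nat. U' n - V' n)" and
    o: "\<And>n. openin X (U n)" "\<And>n. openin X (V n)" "\<And>n. openin X (U' n)" "\<And>n. openin X (V' n)"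
    using assms by (auto simp: 2 Sigma0_2)
  have "(U n - V n) \<inter> (U' m - V' m) \<in> Sigma0 X \<alpha>" for n m
  proof -
      have "(U n - V n) \<inter> (U' m - V' m) = (U n \<inter> U' m) - (V n \<union> V' m)"
        by auto
      then show ?thesis
        unfolding 2 using o by (auto intro!: openin_Diff_in_Sigma0_2)
    qed
  then have "(\<Union>n. \<Union>m. (U n - V n) \<inter> (U' m - V' m)) \<in> Sigma0 X \<alpha>"
    by (intro Sigma0_Union)
  moreover have "S \<inter> T = (\<Union>n. \<Union>m. (U n - V n) \<inter> (U' m - V' m))"
    unfolding S by auto
  ultimately show ?thesis
    by simp
next
  case 3
  obtain B B' where S: "S = (\<Union>n::nat. topspace X - B n)" "T = (\<Union>n::nat. topspace X - B' n)"
    and B: "\<And>n. \<exists>\<beta>. 0 < \<beta> \<and> \<beta> < \<alpha> \<and> B n \<in> Sigma0 X \<beta>"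
      "\<And>n. \<exists>\<beta>. 0 < \<beta> \<and> \<beta> < \<alpha> \<and> B' n \<in> Sigma0 X \<beta>"
    using assms by (auto simp: Sigma0_above_2[OF 3])
  have "topspace X - (B n \<union> B' m) \<in> Sigma0 X \<alpha>" for n m
  proof -
    obtain \<beta> \<gamma> where b: "0 < \<beta>" "\<beta> < \<alpha>" "B n \<in> Sigma0 X \<beta>" "0 < \<gamma>" "\<gamma> < \<alpha>" "B' m \<in> Sigma0 X \<gamma>"
      using B by metis
    then have "B n \<union> B' m \<in> Sigma0 X (max \<beta> \<gamma>)"
      by (intro Sigma0_Un) (auto elim!: Sigma0_mono)
    with b show ?thesis
      by (auto elim!: Sigma0_Compl simp: less_max_iff_disj)
  qed
  then have "(\<Union>n. \<Union>m. topspace X - (B n \<union> B' m)) \<in> Sigma0 X \<alpha>"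
    by (intro Sigma0_Union)
  moreover have "S \<inter> T = (\<Union>n. \<Union>m. topspace X - (B n \<union> B' m))"
    unfolding S by auto
  ultimately show ?thesis
    by simp
qed

lemma Sigma0_Diff:
  assumes "P \<in> Sigma0 X \<beta>" "Q \<in> Sigma0 X \<beta>" "0 < \<beta>" "\<beta> < \<alpha>"
  shows "P - Q \<in> Sigma0 X \<alpha>"
proof -
  have "P \<inter> (topspace X - Q) \<in> Sigma0 X \<alpha>"
    using assms Sigma0_mono[of P X \<beta> \<alpha>] by (auto intro: Sigma0_Int Sigma0_Compl)
  then show ?thesis
    using Sigma0_subset_topspace[OF assms(1)] by (simp add: Int_Diff[symmetric] Int_absorb2)
qed

text \<open>From index \<open>2\<close> on, each class consists of the countable unions of differences of two sets
  that lie in one and the same lower class. This form makes it unnecessary to treat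
  \<open>\<Sigma>\<^sup>0\<^sub>2\<close> separately in the sequel.\<close>

lemma Sigma0_UN_differences:
  assumes "\<And>n::nat. \<exists>\<beta>. 0 < \<beta> \<and> \<beta> < \<alpha> \<and> P n \<in> Sigma0 X \<beta> \<and> Q n \<in> Sigma0 X \<beta>"
  shows "(\<Union>n. P n - Q n) \<in> Sigma0 X \<alpha>"
proof (rule Sigma0_Union)
  show "P n - Q n \<in> Sigma0 X \<alpha>" for n
    using assms[of n] Sigma0_Diff[of "P n" X _ "Q n" \<alpha>] by blast
qed

lemma Sigma0_as_UN_differences:
  assumes "S \<in> Sigma0 X \<alpha>" "1 < \<alpha>"
  obtains P Q where "S = (\<Union>n::nat. P n - Q n)"
    "\<And>n. \<exists>\<beta>. 0 < \<beta> \<and> \<beta> < \<alpha> \<and> P n \<in> Sigma0 X \<beta> \<and> Q n \<in> Sigma0 X \<beta>"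
  using Sigma0_pos[OF assms(1)]
proof (cases rule: omega1_cases_from_1)
  case 1
  then show thesis
    using assms(2) by simp
next
  case 2
  then obtain U V where UV: "S = (\<Union>n::nat. U n - V n)" "\<And>n. openin X (U n) \<and> openin X (V n)"
    using assms(1) by (auto simp: Sigma0_2)
  show thesis
  proof (rule that[OF UV(1)])
    show "\<exists>\<beta>. 0 < \<beta> \<and> \<beta> < \<alpha> \<and> U n \<in> Sigma0 X \<beta> \<and> V n \<in> Sigma0 X \<beta>" for n
      using UV(2) assms(2) zero_less_one_omega1 by (intro exI[of _ 1]) (simp add: Sigma0_1)
  qed
next
  case 3
  then obtain B where B: "S = (\<Union>n::nat. topspace X - B n)"
      "\<And>n. \<exists>\<beta>. 0 < \<beta> \<and> \<beta> < \<alpha> \<and> B n \<in> Sigma0 X \<beta>"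
    using assms(1) by (auto simp: Sigma0_above_2)
  show thesis
  proof (rule that[OF B(1)])
    show "\<exists>\<beta>. 0 < \<beta> \<and> \<beta> < \<alpha> \<and> topspace X \<in> Sigma0 X \<beta> \<and> B n \<in> Sigma0 X \<beta>" for n
      using B(2)[of n] openin_Sigma0[OF openin_topspace] by blast
  qed
qed

lemma Sigma0_preimage:
  assumes "continuous_map X Y h"
  shows "S \<in> Sigma0 Y \<alpha> \<Longrightarrow> h -` S \<inter> topspace X \<in> Sigma0 X \<alpha>"
proof (induction \<alpha> arbitrary: S rule: less_induct)
  case (less \<alpha>)
  consider "\<alpha> = 0" | "\<alpha> = 1" | "1 < \<alpha>"
    using zero_le_omega1[of \<alpha>] one_le_iff_omega1[of \<alpha>] by (metis order.order_iff_strict)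
  then show ?case
  proof cases
    case 1
    then show ?thesis
      using less.prems by (simp add: Sigma0_0)
  next
    case 2
    then show ?thesis
      using less.prems openin_continuous_map_preimage[OF assms, of S]
      by (simp add: Sigma0_1 vimage_def Int_def conj_commute)
  next
    case 3
    with less.prems obtain P Q where S: "S = (\<Union>n::nat. P n - Q n)"
      and PQ: "\<And>n. \<exists>\<beta>. 0 < \<beta> \<and> \<beta> < \<alpha> \<and> P n \<in> Sigma0 Y \<beta> \<and> Q n \<in> Sigma0 Y \<beta>"
      by (rule Sigma0_as_UN_differences) (rule that)
    have "h -` S \<inter> topspace X = (\<Union>n. (h -` P n \<inter> topspace X) - (h -` Q n \<inter> topspace X))"
      unfolding S by auto
    also have "\<dots> \<in> Sigma0 X \<alpha>"
    proof (rule Sigma0_UN_differences)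
      show "\<exists>\<beta>. 0 < \<beta> \<and> \<beta> < \<alpha> \<and> h -` P n \<inter> topspace X \<in> Sigma0 X \<beta> \<and>
          h -` Q n \<inter> topspace X \<in> Sigma0 X \<beta>" for n
        using PQ[of n] less.IH by blast
    qed
    finally show ?thesis .
  qed
qed

section \<open>Baire space\<close>

definition cylinder :: "nat list \<Rightarrow> (nat \<Rightarrow> nat) set" where
  "cylinder \<sigma> = {a. \<forall>i<length \<sigma>. a i = \<sigma> ! i}"

text \<open>A point of Baire space codes the sequence of its slices.\<close>

definition slice :: "nat \<Rightarrow> (nat \<Rightarrow> nat) \<Rightarrow> nat \<Rightarrow> nat" where
  "slice i a = (\<lambda>n. a (prod_encode (i, n)))"

lemma topspace_baire_space [simp]: "topspace baire_space = UNIV"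
  by (simp add: baire_space_def)

lemma continuous_map_baire_coordinate:
  "continuous_map baire_space (discrete_topology UNIV) (\<lambda>a. a i)"
  unfolding baire_space_def by (rule continuous_map_product_projection) simp

lemma continuous_map_into_baire:
  "continuous_map Y baire_space f \<longleftrightarrow>
    (\<forall>k. continuous_map Y (discrete_topology UNIV) (\<lambda>y. f y k))"
  unfolding baire_space_def by (rule continuous_map_componentwise_UNIV)

lemma openin_baire_coordinate: "openin baire_space {a. P (a i)}"
  using openin_continuous_map_preimage[OF continuous_map_baire_coordinate, of "{n. P n}" i] by simp

lemma openin_cylinder: "openin baire_space (cylinder \<sigma>)"
proof -
  have "openin baire_space ((\<Inter>i\<in>{..<length \<sigma>}. {a. a i = \<sigma> ! i}) \<inter> topspace baire_space)"
    by (rule openin_INT) (auto intro: openin_baire_coordinate)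
  moreover have "(\<Inter>i\<in>{..<length \<sigma>}. {a. a i = \<sigma> ! i}) \<inter> topspace baire_space = cylinder \<sigma>"
    by (auto simp: cylinder_def)
  ultimately show ?thesis
    by simp
qed

lemma closedin_cylinder: "closedin baire_space (cylinder \<sigma>)"
proof -
  have "openin baire_space (\<Union>i\<in>{..<length \<sigma>}. {a. a i \<noteq> \<sigma> ! i})"
    by (intro openin_Union) (auto intro: openin_baire_coordinate)
  moreover have "(\<Union>i\<in>{..<length \<sigma>}. {a. a i \<noteq> \<sigma> ! i}) = topspace baire_space - cylinder \<sigma>"
    by (auto simp: cylinder_def)
  ultimately show ?thesis
    by (simp add: closedin_def)
qed

lemma cylinder_basis:
  assumes "openin baire_space U" "a \<in> U"
  obtains \<sigma> where "a \<in> cylinder \<sigma>" "cylinder \<sigma> \<subseteq> U"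
proof -
  obtain V :: "nat \<Rightarrow> nat set" where V: "a \<in> (\<Pi>\<^sub>E i\<in>UNIV. V i)" "finite {i. V i \<noteq> UNIV}"
      "(\<Pi>\<^sub>E i\<in>UNIV. V i) \<subseteq> U"
    using product_topology_open_contains_basis[OF assms[unfolded baire_space_def]] by auto
  from V(2) obtain n where n: "\<And>i. V i \<noteq> UNIV \<Longrightarrow> i < n"
    using finite_nat_set_iff_bounded by auto
  have "cylinder (map a [0..<n]) \<subseteq> U"
  proof
    fix b assume b: "b \<in> cylinder (map a [0..<n])"
    have "b i \<in> V i" for i
    proof (cases "i < n")
      case True
      then show ?thesis
        using b V(1) by (auto simp: cylinder_def PiE_iff)
    next
      case False
      then show ?thesis
        using n by auto
    qed
    then show "b \<in> U"
      using V(3) by (auto simp: PiE_iff)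
  qed
  moreover have "a \<in> cylinder (map a [0..<n])"
    by (auto simp: cylinder_def)
  ultimately show ?thesis
    using that by blast
qed

lemma continuous_map_if_clopen:
  assumes "openin Y S" "closedin Y S"
  shows "continuous_map Y (discrete_topology UNIV) (\<lambda>y. if y \<in> S then c else d)"
proof -
  have "openin Y {y \<in> topspace Y. (if y \<in> S then c else d) \<in> U}" for U
  proof -
    have "{y \<in> topspace Y. (if y \<in> S then c else d) \<in> U} =
        (if c \<in> U then S else {}) \<union> (if d \<in> U then topspace Y - S else {})"
      using openin_subset[OF assms(1)] by auto
    moreover have "openin Y (topspace Y - S)"
      using assms(2) by (simp add: closedin_def)
    ultimately show ?thesis
      using assms(1) by auto
  qed
  then show ?thesis
    by (simp add: continuous_map_def)
qed

lemma continuous_map_slice: "continuous_map baire_space baire_space (slice i)"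
  by (simp add: continuous_map_into_baire slice_def continuous_map_baire_coordinate)

lemma slices_realize:
  assumes "\<And>i. continuous_map baire_space baire_space (g i)"
  obtains f where "continuous_map baire_space baire_space f" "\<And>i a. slice i (f a) = g i a"
proof
  define f where "f = (\<lambda>a k. g (fst (prod_decode k)) a (snd (prod_decode k)))"
  show "continuous_map baire_space baire_space f"
    using assms by (simp add: continuous_map_into_baire f_def)
  show "slice i (f a) = g i a" for i a
    by (simp add: slice_def f_def)
qed

abbreviation baire_times :: "'x topology \<Rightarrow> ((nat \<Rightarrow> nat) \<times> 'x) topology" where
  "baire_times X \<equiv> prod_topology baire_space X"

text \<open>A change of code which keeps the point of the second space.\<close>

abbreviation reparam :: "((nat \<Rightarrow> nat) \<Rightarrow> nat \<Rightarrow> nat) \<Rightarrow> (nat \<Rightarrow> nat) \<times> 'x \<Rightarrow> (nat \<Rightarrow> nat) \<times> 'x" where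
  "reparam f \<equiv> map_prod f id"

lemma reparam_in_topspace:
  "reparam f z \<in> topspace (baire_times X) \<longleftrightarrow> z \<in> topspace (baire_times X)"
  by (cases z) auto

lemma reparam_reparam: "(\<And>a. g (f a) = h a) \<Longrightarrow> reparam g (reparam f z) = reparam h z"
  by (cases z) simp

lemma continuous_map_reparam:
  assumes "continuous_map baire_space baire_space f"
  shows "continuous_map (baire_times X) (baire_times X) (reparam f)"
proof -
  have "continuous_map (baire_times X) (baire_times X) (\<lambda>(a, x). (f a, id x))"
    using assms by (subst continuous_map_prod_top) simp
  then show ?thesis
    by (simp add: map_prod_def)
qed

section \<open>Universal sets\<close>

definition enumerates_base :: "'x topology \<Rightarrow> (nat \<Rightarrow> 'x set) \<Rightarrow> bool" where
  "enumerates_base X B \<longleftrightarrow> (\<forall>k. openin X (B k)) \<and>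
    (\<forall>U x. openin X U \<and> x \<in> U \<longrightarrow> (\<exists>k. x \<in> B k \<and> B k \<subseteq> U))"

lemma enumerates_base_openin: "enumerates_base X B \<Longrightarrow> openin X (B k)"
  by (simp add: enumerates_base_def)

lemma enumerates_base_obtain:
  assumes "enumerates_base X B" "openin X U" "x \<in> U"
  obtains k where "x \<in> B k" "B k \<subseteq> U"
  using assms unfolding enumerates_base_def by blast

definition basic_box :: "(nat \<Rightarrow> 'x set) \<Rightarrow> nat \<Rightarrow> ((nat \<Rightarrow> nat) \<times> 'x) set" where
  "basic_box B n = (case from_nat n of (\<sigma>, k) \<Rightarrow> cylinder \<sigma> \<times> B k)"

lemma second_countable_enumerates_base:
  assumes "second_countable X"
  obtains B where "enumerates_base X B"
proof -
  obtain \<B> where \<B>: "countable \<B>" "\<And>V. V \<in> \<B> \<Longrightarrow> openin X V"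
      "\<And>U x. openin X U \<Longrightarrow> x \<in> U \<Longrightarrow> \<exists>V\<in>\<B>. x \<in> V \<and> V \<subseteq> U"
    using assms unfolding second_countable_def by metis
  define B where "B = from_nat_into (insert {} \<B>)"
  have range: "range B = insert {} \<B>"
    unfolding B_def by (rule range_from_nat_into) (use \<B>(1) in auto)
  have "enumerates_base X B"
    unfolding enumerates_base_def
  proof (intro conjI allI impI)
    fix k
    have "B k \<in> insert {} \<B>"
      using range by blast
    then show "openin X (B k)"
      using \<B>(2) by auto
  next
    fix U x assume "openin X U \<and> x \<in> U"
    then obtain V where "V \<in> \<B>" "x \<in> V" "V \<subseteq> U"
      using \<B>(3) by blast
    moreover then obtain k where "V = B k"
      using range by (metis insertI2 rangeE)
    ultimately show "\<exists>k. x \<in> B k \<and> B k \<subseteq> U"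
      by blast
  qed
  then show ?thesis
    by (rule that)
qed

text \<open>The clopen sets given by zero-dimensionality may be uncountably many. One clopen set is
  chosen for every pair of members of a countable base with a clopen set in between; these
  countably many sets suffice.\<close>

lemma zero_dimensional_enumerates_clopen_base:
  assumes "enumerates_base X B" "zero_dimensional X"
  obtains B' where "enumerates_base X B'" "\<And>k. closedin X (B' k)"
proof -
  obtain \<B> where \<B>: "\<And>V. V \<in> \<B> \<Longrightarrow> openin X V" "\<And>V. V \<in> \<B> \<Longrightarrow> closedin X V"
      "\<And>U x. openin X U \<Longrightarrow> x \<in> U \<Longrightarrow> \<exists>V\<in>\<B>. x \<in> V \<and> V \<subseteq> U"
    using assms(2) unfolding zero_dimensional_def by metis
  define between where "between = (\<lambda>k l V. openin X V \<and> closedin X V \<and> B k \<subseteq> V \<and> V \<subseteq> B l)"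
  define C where "C = (\<lambda>(k, l). if \<exists>V. between k l V then SOME V. between k l V else {})"
  have C_between: "between k l (C (k, l))" if "between k l V" for k l V
    using that someI[of "between k l" V] by (auto simp: C_def)
  have C_clopen: "openin X (C p) \<and> closedin X (C p)" for p
  proof (cases p)
    case (Pair k l)
    show ?thesis
    proof (cases "\<exists>V. between k l V")
      case True
      then show ?thesis
        using C_between unfolding between_def Pair by blast
    next
      case False
      then have "C p = {}"
        unfolding C_def Pair prod.case by (rule if_not_P)
      then show ?thesis
        by simp
    qed
  qed
  have "\<exists>p. x \<in> C p \<and> C p \<subseteq> U" if U: "openin X U" "x \<in> U" for U x
  proof -
    obtain l where l: "x \<in> B l" "B l \<subseteq> U"
      by (rule enumerates_base_obtain[OF assms(1) U])
    obtain V where V: "V \<in> \<B>" "x \<in> V" "V \<subseteq> B l"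
      using \<B>(3)[OF enumerates_base_openin[OF assms(1)] l(1)] by blast
    obtain k where k: "x \<in> B k" "B k \<subseteq> V"
      by (rule enumerates_base_obtain[OF assms(1) \<B>(1)[OF V(1)] V(2)])
    have "between k l V"
      using V k \<B>(1,2) by (simp add: between_def)
    then have "between k l (C (k, l))"
      by (rule C_between)
    then show ?thesis
      using k l unfolding between_def by blast
  qed
  then have "\<exists>n. x \<in> C (prod_decode n) \<and> C (prod_decode n) \<subseteq> U" if "openin X U" "x \<in> U" for U x
    using that by (metis prod_encode_inverse)
  then have "enumerates_base X (\<lambda>n. C (prod_decode n))"
    unfolding enumerates_base_def using C_clopen by blast
  then show ?thesis
    using that C_clopen by blast
qed

lemma open_eq_Union_boxes:
  assumes "enumerates_base X B" "openin (baire_times X) V"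
  shows "V = (\<Union>n. if basic_box B n \<subseteq> V then basic_box B n else {})"
proof (intro subset_antisym subsetI)
  fix z assume "z \<in> V"
  obtain a x where z: "z = (a, x)"
    by (cases z)
  obtain U W where UW: "openin baire_space U" "openin X W" "a \<in> U" "x \<in> W" "U \<times> W \<subseteq> V"
    using openin_prod_topology_alt[THEN iffD1, OF assms(2), rule_format, OF \<open>z \<in> V\<close>[unfolded z]]
    by (elim exE conjE) (rule that)
  obtain \<sigma> where \<sigma>: "a \<in> cylinder \<sigma>" "cylinder \<sigma> \<subseteq> U"
    using cylinder_basis UW(1,3) by blast
  obtain k where k: "x \<in> B k" "B k \<subseteq> W"
    by (rule enumerates_base_obtain[OF assms(1) UW(2,4)])
  have box_eq: "basic_box B (to_nat (\<sigma>, k)) = cylinder \<sigma> \<times> B k"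
    by (simp add: basic_box_def)
  have "basic_box B (to_nat (\<sigma>, k)) \<subseteq> V" "z \<in> basic_box B (to_nat (\<sigma>, k))"
    using \<sigma> k UW(5) unfolding box_eq z by auto
  then show "z \<in> (\<Union>n. if basic_box B n \<subseteq> V then basic_box B n else {})"
    by (intro UN_I[of "to_nat (\<sigma>, k)"]) auto
qed (auto split: if_splits)

text \<open>Every set of the class is obtained from one of them by a continuous change of code. The
  universal set lives in \<open>\<N> \<times> X\<close> itself, not in a product with a further copy of \<open>\<N>\<close>.\<close>

definition has_universal_set :: "'x topology \<Rightarrow> ((nat \<Rightarrow> nat) \<times> 'x) set set \<Rightarrow> bool" where
  "has_universal_set X \<Gamma> \<longleftrightarrow> (\<exists>W\<in>\<Gamma>. \<forall>V\<in>\<Gamma>. \<exists>f. continuous_map baire_space baire_space f \<and>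
    V = reparam f -` W \<inter> topspace (baire_times X))"

text \<open>A code lists indices of basic sets of \<open>X\<close>, with \<open>0\<close> standing for no set. An open
  \<open>V \<subseteq> \<N> \<times> X\<close> is the union of the boxes inside it, and the list at \<open>a\<close> contains the second
  factor of such a box exactly if \<open>a\<close> is in the first one, a clopen condition on \<open>a\<close>.\<close>

lemma universal_set_open:
  assumes B: "enumerates_base X B"
  shows "has_universal_set X (Sigma0 (baire_times X) 1)"
proof -
  define W where "W = (\<Union>n. \<Union>k. {a :: nat \<Rightarrow> nat. a n = Suc k} \<times> B k)"
  have W: "openin (baire_times X) W"
    unfolding W_def using B openin_baire_coordinate[of "\<lambda>m. m = Suc k" for k]
    by (intro openin_Union) (auto simp: enumerates_base_def openin_prod_Times_iff)
  have "\<exists>f. continuous_map baire_space baire_space f \<and>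
      V = reparam f -` W \<inter> topspace (baire_times X)" if V: "openin (baire_times X) V" for V
  proof (intro exI conjI)
    define f where "f = (\<lambda>a n. case from_nat n of (\<sigma>, k) \<Rightarrow>
      if a \<in> cylinder \<sigma> then if basic_box B n \<subseteq> V then Suc k else 0 else 0)"
    show "continuous_map baire_space baire_space f"
      unfolding continuous_map_into_baire
    proof
      fix n
      obtain \<sigma> :: "nat list" and k :: nat where "from_nat n = (\<sigma>, k)"
        by fastforce
      then show "continuous_map baire_space (discrete_topology UNIV) (\<lambda>a. f a n)"
        unfolding f_def
        by (simp add: continuous_map_if_clopen openin_cylinder closedin_cylinder del: if_cancel)
    qed
    have "(f a, x) \<in> W \<longleftrightarrow> (a, x) \<in> V" for a x
    proof
      assume "(f a, x) \<in> W"
      then obtain n k where nk: "f a n = Suc k" "x \<in> B k"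
        by (auto simp: W_def)
      then have "basic_box B n \<subseteq> V" "(a, x) \<in> basic_box B n"
        by (auto simp: f_def basic_box_def split: prod.splits if_splits)
      then show "(a, x) \<in> V"
        by blast
    next
      assume "(a, x) \<in> V"
      then obtain n where n: "basic_box B n \<subseteq> V" "(a, x) \<in> basic_box B n"
        using open_eq_Union_boxes[OF B V] by (auto split: if_splits)
      obtain \<sigma> :: "nat list" and k :: nat where "from_nat n = (\<sigma>, k)"
        by fastforce
      then have "f a n = Suc k" "x \<in> B k"
        using n by (auto simp: f_def basic_box_def)
      then show "(f a, x) \<in> W"
        unfolding W_def by blast
    qed
    then show "V = reparam f -` W \<inter> topspace (baire_times X)"
      using openin_subset[OF V] by auto
  qed
  then show ?thesis
    using W unfolding has_universal_set_def Sigma0_1 by blast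
qed

text \<open>A code for a set of class \<open>\<alpha>\<close> consists of codes for the sets in a representation as a
  countable union of differences. The lower class from which the \<open>n\<close>-th difference is taken is
  fixed by \<open>n\<close> alone, in such a way that each lower class occurs infinitely often; unused places
  are filled with empty differences.\<close>

lemma universal_set_Sigma0:
  assumes B: "enumerates_base X B"
  shows "0 < \<alpha> \<Longrightarrow> has_universal_set X (Sigma0 (baire_times X) \<alpha>)"
proof (induction \<alpha> rule: less_induct)
  case (less \<alpha>)
  let ?Z = "topspace (baire_times X)"
  show ?case
  proof (cases "\<alpha> = 1")
    case True
    then show ?thesis
      using universal_set_open[OF B] by simp
  next
    case False
    then have \<alpha>: "1 < \<alpha>"
      using less.prems one_le_iff_omega1[of \<alpha>] by (simp add: order.order_iff_strict)
    define I where "I = {\<beta>. 0 < \<beta> \<and> \<beta> < \<alpha>}"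
    have "countable I"
      by (rule countable_subset[OF _ countable_lessThan_omega1[of \<alpha>]]) (auto simp: I_def)
    moreover have "I \<noteq> {}"
      using \<alpha> zero_less_one_omega1 by (auto simp: I_def)
    ultimately have range: "range (from_nat_into I) = I"
      by (intro range_from_nat_into)
    define e where "e = (\<lambda>n. from_nat_into I (snd (prod_decode n)))"
    have e: "0 < e n" "e n < \<alpha>" for n
      using range unfolding e_def I_def by blast+
    have "\<forall>n. \<exists>W. W \<in> Sigma0 (baire_times X) (e n) \<and> (\<forall>V\<in>Sigma0 (baire_times X) (e n).
        \<exists>f. continuous_map baire_space baire_space f \<and> V = reparam f -` W \<inter> ?Z)"
      using less.IH[OF e(2) e(1)] unfolding has_universal_set_def by blast
    then obtain W where W: "\<And>n. W n \<in> Sigma0 (baire_times X) (e n)"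
        "\<And>n V. V \<in> Sigma0 (baire_times X) (e n) \<Longrightarrow>
          \<exists>f. continuous_map baire_space baire_space f \<and> V = reparam f -` W n \<inter> ?Z"
      by metis
    have preimage: "reparam (slice i) -` W n \<inter> ?Z \<in> Sigma0 (baire_times X) (e n)" for i n
      by (rule Sigma0_preimage[OF continuous_map_reparam[OF continuous_map_slice] W(1)])
    define W' where "W' = (\<Union>n. (reparam (slice (2 * n)) -` W n \<inter> ?Z) -
      (reparam (slice (2 * n + 1)) -` W n \<inter> ?Z))"
    have "W' \<in> Sigma0 (baire_times X) \<alpha>"
      unfolding W'_def
      by (rule Sigma0_Union, rule Sigma0_Diff[OF preimage preimage e])
    moreover have "\<exists>f. continuous_map baire_space baire_space f \<and> V = reparam f -` W' \<inter> ?Z"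
      if V: "V \<in> Sigma0 (baire_times X) \<alpha>" for V
    proof -
      obtain P Q where V_eq: "V = (\<Union>j::nat. P j - Q j)" and PQ: "\<And>j. \<exists>\<beta>. 0 < \<beta> \<and> \<beta> < \<alpha> \<and>
          P j \<in> Sigma0 (baire_times X) \<beta> \<and> Q j \<in> Sigma0 (baire_times X) \<beta>"
        using V \<alpha> by (rule Sigma0_as_UN_differences) (rule that)
      \<comment> \<open>place \<open>n = (j, m)\<close> holds the \<open>j\<close>-th difference if the \<open>m\<close>-th lower class
          contains both of its sets\<close>
      define ok where "ok = (\<lambda>n. P (fst (prod_decode n)) \<in> Sigma0 (baire_times X) (e n) \<and>
        Q (fst (prod_decode n)) \<in> Sigma0 (baire_times X) (e n))"
      define P' where "P' = (\<lambda>n. if ok n then P (fst (prod_decode n)) else {})"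
      define Q' where "Q' = (\<lambda>n. if ok n then Q (fst (prod_decode n)) else {})"
      have PQ': "P' n \<in> Sigma0 (baire_times X) (e n)" "Q' n \<in> Sigma0 (baire_times X) (e n)" for n
        using openin_Sigma0[OF openin_empty e(1)] by (auto simp: P'_def Q'_def ok_def)
      have V_eq': "V = (\<Union>n. P' n - Q' n)"
      proof (intro subset_antisym subsetI)
        fix z assume "z \<in> V"
        then obtain j where j: "z \<in> P j - Q j"
          using V_eq by blast
        obtain \<beta> where \<beta>: "\<beta> \<in> I" "P j \<in> Sigma0 (baire_times X) \<beta>"
            "Q j \<in> Sigma0 (baire_times X) \<beta>"
          using PQ[of j] by (auto simp: I_def)
        obtain m where "\<beta> = from_nat_into I m"
          using \<beta>(1) range by (metis rangeE)
        with \<beta> have "ok (prod_encode (j, m))"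
          by (simp add: ok_def e_def)
        then have "z \<in> P' (prod_encode (j, m)) - Q' (prod_encode (j, m))"
          using j by (simp add: P'_def Q'_def)
        then show "z \<in> (\<Union>n. P' n - Q' n)"
          by blast
      next
        fix z assume "z \<in> (\<Union>n. P' n - Q' n)"
        then show "z \<in> V"
          by (auto simp: P'_def Q'_def V_eq split: if_splits)
      qed
      obtain f where f: "\<And>n. continuous_map baire_space baire_space (f n)"
          "\<And>n. P' n = reparam (f n) -` W n \<inter> ?Z"
        using W(2)[OF PQ'(1)] by metis
      obtain h where h: "\<And>n. continuous_map baire_space baire_space (h n)"
          "\<And>n. Q' n = reparam (h n) -` W n \<inter> ?Z"
        using W(2)[OF PQ'(2)] by metis
      have "continuous_map baire_space baire_space (if even i then f (i div 2) else h (i div 2))"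
        for i using f(1) h(1) by simp
      then obtain F where F: "continuous_map baire_space baire_space F"
          "\<And>i a. slice i (F a) = (if even i then f (i div 2) else h (i div 2)) a"
        by (rule slices_realize) (rule that)
      have "reparam F -` W' \<inter> ?Z = (\<Union>n. P' n - Q' n)"
        unfolding W'_def f(2) h(2)
        by (auto simp: F(2))
      then show ?thesis
        using F(1) V_eq' by blast
    qed
    ultimately show ?thesis
      unfolding has_universal_set_def by blast
  qed
qed

section \<open>Reduction\<close>

definition has_reduction :: "'z set set \<Rightarrow> bool" where
  "has_reduction \<Gamma> \<longleftrightarrow> (\<forall>V. (\<forall>i::nat. V i \<in> \<Gamma>) \<longrightarrow> (\<exists>R. (\<forall>i. R i \<in> \<Gamma> \<and> R i \<subseteq> V i) \<and>
    (\<forall>i j. i \<noteq> j \<longrightarrow> R i \<inter> R j = {}) \<and> (\<Union>i. R i) = (\<Union>i. V i)))"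

text \<open>If each \<open>V i\<close> is a countable union of sets which are in the class together with their
  complements, list all these sets in one sequence and remove from each the ones before it. The
  results are still in the class; \<open>R i\<close> collects those that came from \<open>V i\<close>.\<close>

lemma has_reduction_if_ambiguous_generated:
  assumes generated: "\<And>V. V \<in> Sigma0 Y \<alpha> \<Longrightarrow>
    \<exists>D. V = (\<Union>n::nat. D n) \<and> (\<forall>n. D n \<in> Sigma0 Y \<alpha> \<and> topspace Y - D n \<in> Sigma0 Y \<alpha>)"
  shows "has_reduction (Sigma0 Y \<alpha>)"
  unfolding has_reduction_def
proof (intro allI impI)
  fix V :: "nat \<Rightarrow> 'a set" assume "\<forall>i. V i \<in> Sigma0 Y \<alpha>"
  then have ex: "\<forall>i. \<exists>D. V i = (\<Union>n::nat. D n) \<and>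
      (\<forall>n. D n \<in> Sigma0 Y \<alpha> \<and> topspace Y - D n \<in> Sigma0 Y \<alpha>)"
    using generated by simp
  obtain D where "\<forall>i. V i = (\<Union>n::nat. D i n) \<and>
      (\<forall>n. D i n \<in> Sigma0 Y \<alpha> \<and> topspace Y - D i n \<in> Sigma0 Y \<alpha>)"
    by (rule exE[OF choice[OF ex]]) (rule that)
  then have D: "\<And>i. V i = (\<Union>n::nat. D i n)" "\<And>i n. D i n \<in> Sigma0 Y \<alpha>"
      "\<And>i n. topspace Y - D i n \<in> Sigma0 Y \<alpha>"
    by simp_all
  define E where "E = (\<lambda>m. case_prod D (prod_decode m))"
  have E: "E m \<in> Sigma0 Y \<alpha>" "topspace Y - E m \<in> Sigma0 Y \<alpha>" for m
    using D(2,3) by (simp_all add: E_def case_prod_unfold)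
  have E_encode: "E (prod_encode (i, n)) = D i n" for i n
    by (simp add: E_def)
  have diff: "E m - (\<Union>k\<in>{0..<l}. E k) \<in> Sigma0 Y \<alpha>" for l m
  proof (induction l)
    case 0
    then show ?case
      using E(1) by simp
  next
    case (Suc l)
    have "E m - (\<Union>k\<in>{0..<Suc l}. E k) = (E m - (\<Union>k\<in>{0..<l}. E k)) \<inter> (topspace Y - E l)"
      using Sigma0_subset_topspace[OF E(1)[of m]] by (auto simp: less_Suc_eq)
    then show ?case
      using Sigma0_Int[OF Suc E(2)] by simp
  qed
  then have disjointed: "disjointed E m \<in> Sigma0 Y \<alpha>" for m
    by (simp add: disjointed_def)
  define R where "R = (\<lambda>i. \<Union>n. disjointed E (prod_encode (i, n)))"
  have "R i \<in> Sigma0 Y \<alpha>" for i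
    unfolding R_def by (intro Sigma0_Union disjointed)
  moreover have "R i \<subseteq> V i" for i
    unfolding R_def D(1) using disjointed_subset[of E] E_encode by blast
  moreover have "R i \<inter> R j = {}" if "i \<noteq> j" for i j
  proof -
    have "disjointed E (prod_encode (i, n)) \<inter> disjointed E (prod_encode (j, k)) = {}" for n k
      using disjoint_family_disjointed[of E] that by (simp add: disjoint_family_on_def)
    then show ?thesis
      unfolding R_def by blast
  qed
  moreover have "(\<Union>i. R i) = (\<Union>i. V i)"
  proof -
    have "(\<Union>i. R i) = (\<Union>m. disjointed E m)"
      unfolding R_def UN_prod_decode by (simp add: case_prod_unfold)
    also have "\<dots> = (\<Union>i. V i)"
      unfolding UN_disjointed_eq D(1) UN_prod_decode E_def ..
    finally show ?thesis .
  qed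
  ultimately show "\<exists>R. (\<forall>i. R i \<in> Sigma0 Y \<alpha> \<and> R i \<subseteq> V i) \<and>
      (\<forall>i j. i \<noteq> j \<longrightarrow> R i \<inter> R j = {}) \<and> (\<Union>i. R i) = (\<Union>i. V i)"
    by (intro exI[of _ R]) simp
qed

lemma Sigma0_has_reduction:
  assumes \<alpha>: "1 < \<alpha>"
  shows "has_reduction (Sigma0 Y \<alpha>)"
proof (rule has_reduction_if_ambiguous_generated)
  fix V assume "V \<in> Sigma0 Y \<alpha>"
  then obtain P Q where V: "V = (\<Union>n::nat. P n - Q n)"
    and PQ: "\<And>n. \<exists>\<beta>. 0 < \<beta> \<and> \<beta> < \<alpha> \<and> P n \<in> Sigma0 Y \<beta> \<and> Q n \<in> Sigma0 Y \<beta>"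
    using \<alpha> by (rule Sigma0_as_UN_differences) (rule that)
  have "P n - Q n \<in> Sigma0 Y \<alpha> \<and> topspace Y - (P n - Q n) \<in> Sigma0 Y \<alpha>" for n
  proof -
    obtain \<beta> where \<beta>: "0 < \<beta>" "\<beta> < \<alpha>" and in_\<beta>: "P n \<in> Sigma0 Y \<beta>" "Q n \<in> Sigma0 Y \<beta>"
      using PQ by blast
    have "topspace Y - (P n - Q n) = (topspace Y - P n) \<union> Q n"
      using Sigma0_subset_topspace[OF in_\<beta>(2)] by auto
    moreover have "(topspace Y - P n) \<union> Q n \<in> Sigma0 Y \<alpha>"
      using \<beta> in_\<beta> by (intro Sigma0_Un Sigma0_Compl[OF in_\<beta>(1)] Sigma0_mono[OF in_\<beta>(2)]) auto
    ultimately show ?thesis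
      using Sigma0_Diff[OF in_\<beta> \<beta>] by simp
  qed
  then show "\<exists>D. V = (\<Union>n::nat. D n) \<and>
      (\<forall>n. D n \<in> Sigma0 Y \<alpha> \<and> topspace Y - D n \<in> Sigma0 Y \<alpha>)"
    using V by (intro exI[of _ "\<lambda>n. P n - Q n"]) simp
qed

lemma open_has_reduction_zero_dimensional:
  assumes B: "enumerates_base X B" and zero: "zero_dimensional X"
  shows "has_reduction (Sigma0 (baire_times X) 1)"
proof (rule has_reduction_if_ambiguous_generated)
  obtain B' where B': "enumerates_base X B'" "\<And>k. closedin X (B' k)"
    using zero_dimensional_enumerates_clopen_base[OF B zero] by blast
  have "openin (baire_times X) (basic_box B' n) \<and> closedin (baire_times X) (basic_box B' n)" for n
    using B' openin_cylinder closedin_cylinder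
    by (auto simp: basic_box_def enumerates_base_def openin_prod_Times_iff closedin_prod_Times_iff
        split: prod.splits)
  then have clopen: "openin (baire_times X) (if basic_box B' n \<subseteq> V then basic_box B' n else {}) \<and>
      openin (baire_times X) (topspace (baire_times X) - (if basic_box B' n \<subseteq> V then basic_box B' n else {}))"
    for V n
    by (cases "basic_box B' n \<subseteq> V") (simp_all add: closedin_def del: topspace_prod_topology)
  fix V assume "V \<in> Sigma0 (baire_times X) 1"
  then have "V = (\<Union>n. if basic_box B' n \<subseteq> V then basic_box B' n else {})"
    by (intro open_eq_Union_boxes[OF B'(1)]) (simp add: Sigma0_1)
  then show "\<exists>D. V = (\<Union>n::nat. D n) \<and> (\<forall>n. D n \<in> Sigma0 (baire_times X) 1 \<and>
      topspace (baire_times X) - D n \<in> Sigma0 (baire_times X) 1)"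
    unfolding Sigma0_1 mem_Collect_eq using clopen[of _ V]
    by (intro exI[of _ "\<lambda>n. if basic_box B' n \<subseteq> V then basic_box B' n else {}"]) simp
qed

section \<open>Parametrizing a level\<close>

text \<open>What the construction of a parametrization requires of the levels of a base.\<close>

definition amenable :: "'x topology \<Rightarrow> ((nat \<Rightarrow> nat) \<times> 'x) set set \<Rightarrow> bool" where
  "amenable X \<Gamma> \<longleftrightarrow> has_universal_set X \<Gamma> \<and> has_reduction \<Gamma> \<and>
    (\<forall>f S. continuous_map baire_space baire_space f \<longrightarrow> S \<in> \<Gamma> \<longrightarrow>
      reparam f -` S \<inter> topspace (baire_times X) \<in> \<Gamma>)"

lemma amenable_universal_set:
  assumes "amenable X \<Gamma>"
  obtains W where "W \<in> \<Gamma>" "\<And>V. V \<in> \<Gamma> \<Longrightarrow>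
    \<exists>f. continuous_map baire_space baire_space f \<and> V = reparam f -` W \<inter> topspace (baire_times X)"
proof -
  have "has_universal_set X \<Gamma>"
    using assms by (simp add: amenable_def)
  then show thesis
    unfolding has_universal_set_def by (elim bexE) (rule that, assumption, drule (1) bspec)
qed

lemma amenable_reduction:
  assumes "amenable X \<Gamma>" "\<And>i::nat. V i \<in> \<Gamma>"
  obtains R where "\<And>i. R i \<in> \<Gamma>" "\<And>i. R i \<subseteq> V i" "\<And>i j. i \<noteq> j \<Longrightarrow> R i \<inter> R j = {}"
    "(\<Union>i. R i) = (\<Union>i. V i)"
proof -
  have "has_reduction \<Gamma>"
    using assms(1) by (simp add: amenable_def)
  then have "\<exists>R. (\<forall>i. R i \<in> \<Gamma> \<and> R i \<subseteq> V i) \<and> (\<forall>i j. i \<noteq> j \<longrightarrow> R i \<inter> R j = {}) \<and>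
      (\<Union>i. R i) = (\<Union>i. V i)"
    using assms(2) by (simp add: has_reduction_def)
  then obtain R where "(\<forall>i. R i \<in> \<Gamma> \<and> R i \<subseteq> V i) \<and> (\<forall>i j. i \<noteq> j \<longrightarrow> R i \<inter> R j = {}) \<and>
      (\<Union>i. R i) = (\<Union>i. V i)" ..
  then show thesis
    by (intro that[of R]) simp_all
qed

lemma amenable_reparam:
  assumes "amenable X \<Gamma>" "continuous_map baire_space baire_space f" "S \<in> \<Gamma>"
  shows "reparam f -` S \<inter> topspace (baire_times X) \<in> \<Gamma>"
  using assms by (simp add: amenable_def)

type_synonym ('x, 'q) partition_class =
  "((nat \<Rightarrow> nat) \<times> 'x) set \<Rightarrow> ((nat \<Rightarrow> nat) \<times> 'x \<Rightarrow> 'q) \<Rightarrow> bool"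

text \<open>Stability under change of code and under restriction of the domain at the same time.\<close>

definition stable :: "'x topology \<Rightarrow> ('x, 'q) partition_class \<Rightarrow> bool" where
  "stable X P \<longleftrightarrow> (\<forall>C A f D B. P C A \<longrightarrow> continuous_map baire_space baire_space f \<longrightarrow>
    D \<subseteq> topspace (baire_times X) \<longrightarrow> (\<forall>z\<in>D. reparam f z \<in> C \<and> B z = A (reparam f z)) \<longrightarrow> P D B)"

text \<open>\<open>H\<close> is required to parametrize functions on every domain \<open>C\<close>, not just on \<open>\<N> \<times> X\<close>:
  in the recursion, the functions for the subterms are only given on parts of the space. This
  includes that functions on a part extend to the whole space within the class.\<close>

definition parametrizes ::
  "'x topology \<Rightarrow> ('x, 'q) partition_class \<Rightarrow> ((nat \<Rightarrow> nat) \<times> 'x \<Rightarrow> 'q) \<Rightarrow> bool" where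
  "parametrizes X P H \<longleftrightarrow> P (topspace (baire_times X)) H \<and>
    (\<forall>C A. C \<subseteq> topspace (baire_times X) \<longrightarrow> P C A \<longrightarrow>
      (\<exists>f. continuous_map baire_space baire_space f \<and> (\<forall>z\<in>C. A z = H (reparam f z))))"

lemma stableD:
  assumes "stable X P" "P C A" "continuous_map baire_space baire_space f"
    and "D \<subseteq> topspace (baire_times X)"
    and "\<And>z. z \<in> D \<Longrightarrow> reparam f z \<in> C" "\<And>z. z \<in> D \<Longrightarrow> B z = A (reparam f z)"
  shows "P D B"
  using assms(1)[unfolded stable_def, rule_format, OF assms(2-4)] assms(5,6) by simp

lemma parametrizes_top: "parametrizes X P H \<Longrightarrow> P (topspace (baire_times X)) H"
  by (simp add: parametrizes_def)

lemma parametrizes_obtain: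
  assumes "parametrizes X P H" "C \<subseteq> topspace (baire_times X)" "P C A"
  obtains f where "continuous_map baire_space baire_space f"
    "\<And>z. z \<in> C \<Longrightarrow> A z = H (reparam f z)"
proof -
  have "\<exists>f. continuous_map baire_space baire_space f \<and> (\<forall>z\<in>C. A z = H (reparam f z))"
    using assms unfolding parametrizes_def by simp
  then obtain f where "continuous_map baire_space baire_space f \<and> (\<forall>z\<in>C. A z = H (reparam f z))" ..
  then show thesis
    by (intro that[of f]) simp_all
qed

text \<open>The combination step. Slice \<open>0\<close> of a code is a code for the function at the root, slice
  \<open>2 i + 1\<close> a code for the \<open>i\<close>-th set, and slice \<open>2 i + 2\<close> a code for the \<open>i\<close>-th function. The
  reduction is applied once, to the sets \<open>V i \<subseteq> \<N> \<times> X\<close> of all pairs \<open>(a, x)\<close> with \<open>x\<close> in the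
  \<open>i\<close>-th set coded by \<open>a\<close>, so that it is uniform in the code. The sets \<open>U i\<close> of a given function
  stay as they are: a point in their union lies in \<open>R i\<close>, after coding, for some \<open>i\<close> with the
  point in \<open>U i\<close>, and there the \<open>i\<close>-th function gives the right value.\<close>

lemma parametrizes_F_term:
  fixes X :: "'x topology"
  assumes amenable: "amenable X \<Gamma>"
    and child: "\<And>i. parametrizes X (P i) (H i)" "\<And>i. stable X (P i)"
    and root: "parametrizes X P\<^sub>0 H\<^sub>0" "stable X P\<^sub>0"
  shows "\<exists>K. parametrizes X
    (\<lambda>C A. \<exists>U. (\<forall>i::nat. U i \<in> \<Gamma> \<and> P i (C \<inter> U i) A) \<and> P\<^sub>0 (C - (\<Union>i. U i)) A) K"
proof -
  let ?Z = "topspace (baire_times X)"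
  obtain W where W: "W \<in> \<Gamma>" "\<And>V. V \<in> \<Gamma> \<Longrightarrow>
      \<exists>f. continuous_map baire_space baire_space f \<and> V = reparam f -` W \<inter> ?Z"
    using amenable by (rule amenable_universal_set) (rule that)
  define V where "V = (\<lambda>i. reparam (slice (2 * i + 1)) -` W \<inter> ?Z)"
  have V_in: "V i \<in> \<Gamma>" for i
    unfolding V_def by (rule amenable_reparam[OF amenable continuous_map_slice W(1)])
  obtain R where R: "\<And>i. R i \<in> \<Gamma>" "\<And>i. R i \<subseteq> V i" "\<And>i j. i \<noteq> j \<Longrightarrow> R i \<inter> R j = {}"
      "(\<Union>i. R i) = (\<Union>i. V i)"
    by (rule amenable_reduction[where V = V, OF amenable V_in]) (rule that)
  define K where "K = (\<lambda>z. if \<exists>i. z \<in> R i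
    then H (THE i. z \<in> R i) (reparam (slice (2 * (THE i. z \<in> R i) + 2)) z)
    else H\<^sub>0 (reparam (slice 0) z))"
  have K_child: "K z = H i (reparam (slice (2 * i + 2)) z)" if "z \<in> R i" for z i
  proof -
    have "(THE i. z \<in> R i) = i"
      using that R(3) by (intro the_equality) blast+
    then show ?thesis
      using that by (auto simp: K_def)
  qed
  have K_root: "K z = H\<^sub>0 (reparam (slice 0) z)" if "z \<notin> (\<Union>i. R i)" for z
    using that by (auto simp: K_def)
  have R_sub: "R i \<subseteq> ?Z" for i
    using R(2)[of i] by (auto simp: V_def)
  have K_in: "P i (?Z \<inter> R i) K" for i
    by (rule stableD[OF child(2) parametrizes_top[OF child(1)] continuous_map_slice[of "2 * i + 2"]])
      (use K_child[of _ i] reparam_in_topspace in blast)+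
  have K_in_root: "P\<^sub>0 (?Z - (\<Union>i. R i)) K"
    by (rule stableD[OF root(2) parametrizes_top[OF root(1)] continuous_map_slice[of 0]])
      (use K_root reparam_in_topspace in blast)+
  have "\<exists>F. continuous_map baire_space baire_space F \<and> (\<forall>z\<in>C. A z = K (reparam F z))"
    if C: "C \<subseteq> ?Z" and U: "\<And>i. U i \<in> \<Gamma>" "\<And>i. P i (C \<inter> U i) A" "P\<^sub>0 (C - (\<Union>i. U i)) A" for C A U
  proof -
    have "\<exists>f. continuous_map baire_space baire_space f \<and> U i = reparam f -` W \<inter> ?Z" for i
      by (rule W(2)[OF U(1)])
    then obtain f where f: "\<And>i. continuous_map baire_space baire_space (f i)"
        "\<And>i. U i = reparam (f i) -` W \<inter> ?Z"
      by metis
    have "\<exists>g. continuous_map baire_space baire_space g \<and> (\<forall>z\<in>C \<inter> U i. A z = H i (reparam g z))" for i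
      using parametrizes_obtain[OF child(1) _ U(2)[of i]] C by (metis le_infI1)
    then obtain g where g: "\<And>i. continuous_map baire_space baire_space (g i)"
        "\<And>i z. z \<in> C \<inter> U i \<Longrightarrow> A z = H i (reparam (g i) z)"
      by metis
    obtain g\<^sub>0 where g\<^sub>0: "continuous_map baire_space baire_space g\<^sub>0"
        "\<And>z. z \<in> C - (\<Union>i. U i) \<Longrightarrow> A z = H\<^sub>0 (reparam g\<^sub>0 z)"
      by (rule parametrizes_obtain[OF root(1) _ U(3)]) (use C that in auto)
    have "continuous_map baire_space baire_space
        (if k = 0 then g\<^sub>0 else if odd k then f (k div 2) else g (k div 2 - 1))" for k
      using f(1) g(1) g\<^sub>0(1) by simp
    then obtain F where F: "continuous_map baire_space baire_space F" "\<And>k a. slice k (F a) =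
        (if k = 0 then g\<^sub>0 else if odd k then f (k div 2) else g (k div 2 - 1)) a"
      by (rule slices_realize) (rule that)
    have slices: "reparam (slice 0) (reparam F z) = reparam g\<^sub>0 z"
        "reparam (slice (2 * i + 1)) (reparam F z) = reparam (f i) z"
        "reparam (slice (2 * i + 2)) (reparam F z) = reparam (g i) z"
      for i and z :: "(nat \<Rightarrow> nat) \<times> 'x"
      by (rule reparam_reparam, simp add: F(2))+
    have in_V: "reparam F z \<in> V i \<longleftrightarrow> z \<in> U i" if "z \<in> ?Z" for z i
      using that unfolding V_def f(2)
      by (simp only: Int_iff vimage_eq reparam_in_topspace slices(2))
    have "A z = K (reparam F z)" if "z \<in> C" for z
    proof (cases "reparam F z \<in> (\<Union>i. R i)")
      case True
      then obtain i where i: "reparam F z \<in> R i"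
        by blast
      then have "z \<in> U i"
        using R(2) in_V that C by blast
      then have "A z = H i (reparam (g i) z)"
        using g(2) that by blast
      also have "\<dots> = K (reparam F z)"
        using K_child[OF i] by (simp only: slices(3))
      finally show ?thesis .
    next
      case False
      then have "z \<notin> (\<Union>i. U i)"
        using in_V that C unfolding R(4) by blast
      then have "A z = H\<^sub>0 (reparam g\<^sub>0 z)"
        using g\<^sub>0(2) that by blast
      also have "\<dots> = K (reparam F z)"
        using K_root[OF False] by (simp only: slices(1))
      finally show ?thesis .
    qed
    then show ?thesis
      using F(1) by blast
  qed
  moreover have "\<exists>U. (\<forall>i. U i \<in> \<Gamma> \<and> P i (?Z \<inter> U i) K) \<and> P\<^sub>0 (?Z - (\<Union>i. U i)) K"
    using R(1) K_in K_in_root by (intro exI[of _ R]) simp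
  ultimately show ?thesis
    unfolding parametrizes_def by (intro exI[of _ K]) blast
qed

lemma stable_in_level:
  assumes "\<And>\<alpha>. amenable X (L \<alpha>)"
  shows "stable X (in_level u L)"
  unfolding stable_def
proof (intro allI impI)
  fix C A f D B
  assume in_C: "in_level u L C A" and f: "continuous_map baire_space baire_space f"
    and D: "D \<subseteq> topspace (baire_times X)"
    and reduces: "\<forall>z\<in>D. reparam f z \<in> C \<and> B z = A (reparam f z)"
  show "in_level u L D B"
  proof (rule in_level_preimage[OF _ in_C D])
    show "reparam f -` S \<inter> topspace (baire_times X) \<in> L \<alpha>" if "S \<in> L \<alpha>" for S \<alpha>
      by (rule amenable_reparam[OF assms f that])
    show "reparam f z \<in> C \<and> B z = A (reparam f z)" if "z \<in> D" for z
      using reduces that by (rule bspec)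
  qed
qed

lemma parametrizes_constant: "parametrizes X (\<lambda>C A. \<forall>x\<in>C. A x = q) (\<lambda>_. q)"
  using continuous_map_id[of baire_space] unfolding parametrizes_def by (metis (full_types))

lemma stable_constant: "stable X (\<lambda>C A. \<forall>x\<in>C. A x = q)"
  by (simp add: stable_def)

text \<open>The base has to be arbitrary in the induction, because \<open>Shift\<close> and \<open>FO\<close> pass to a shifted
  base. All levels of a shifted base are levels of the original one.\<close>

lemma exists_parametrization:
  "(\<And>\<alpha>. amenable X (L \<alpha>)) \<Longrightarrow> \<exists>H. parametrizes X (in_level u L) H"
proof (induction u arbitrary: L)
  case (Const q)
  show ?case
    unfolding in_level.simps by (rule exI, rule parametrizes_constant)
next
  case (Shift \<alpha> u)
  then show ?case
    by (simp add: shift_base_def)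
next
  case (FQ q us)
  have "\<exists>H. parametrizes X (in_level (us i) L) H" for i
    by (rule FQ.IH[OF rangeI FQ.prems])
  then obtain H where H: "parametrizes X (in_level (us i) L) (H i)" for i
    using choice[of "\<lambda>i. parametrizes X (in_level (us i) L)"] by blast
  show ?case
    unfolding in_level.simps
    by (rule parametrizes_F_term[OF FQ.prems H stable_in_level[OF FQ.prems]
          parametrizes_constant stable_constant])
next
  case (FO \<alpha> us)
  let ?L = "shift_base (omega_pow \<alpha>) L"
  have shift: "\<And>\<beta>. amenable X (?L \<beta>)"
    using FO.prems by (simp add: shift_base_def)
  have "\<exists>H. parametrizes X (in_level (us (Suc i)) L) H" for i
    by (rule FO.IH[OF rangeI FO.prems])
  then obtain H where H: "parametrizes X (in_level (us (Suc i)) L) (H i)" for i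
    using choice[of "\<lambda>i. parametrizes X (in_level (us (Suc i)) L)"] by blast
  obtain H\<^sub>0 where H\<^sub>0: "parametrizes X (in_level (us 0) ?L) H\<^sub>0"
    using FO.IH[of "us 0" ?L, OF rangeI shift] by blast
  show ?case
    unfolding in_level.simps
    by (rule parametrizes_F_term[OF FO.prems H stable_in_level[OF FO.prems] H\<^sub>0
          stable_in_level[OF shift]])
qed

section \<open>Principal representations\<close>

lemma level_in_Sigma0:
  assumes "\<And>\<alpha>. 0 < g \<alpha>"
  shows "level_in (topspace Y) (\<lambda>\<alpha>. Sigma0 Y (g \<alpha>)) u =
    {A \<in> extensional (topspace Y). in_level u (\<lambda>\<alpha>. Sigma0 Y (g \<alpha>)) (topspace Y) A}"
proof -
  have "restrict_base (topspace Y) (\<lambda>\<alpha>. Sigma0 Y (g \<alpha>)) = (\<lambda>\<alpha>. Sigma0 Y (g \<alpha>))"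
  proof
    fix \<alpha>
    have "topspace Y \<inter> S = S" if "S \<in> Sigma0 Y (g \<alpha>)" for S
      using Sigma0_subset_topspace[OF that] by blast
    then show "restrict_base (topspace Y) (\<lambda>\<alpha>. Sigma0 Y (g \<alpha>)) \<alpha> = Sigma0 Y (g \<alpha>)"
      unfolding restrict_base_def by force
  qed
  then have "(\<exists>F. is_family u (topspace Y) (\<lambda>\<alpha>. Sigma0 Y (g \<alpha>)) F \<and>
      determines u (topspace Y) (\<lambda>\<alpha>. Sigma0 Y (g \<alpha>)) F A) \<longleftrightarrow>
      in_level u (\<lambda>\<alpha>. Sigma0 Y (g \<alpha>)) (topspace Y) A" for A
    using determined_on_iff_in_level[where L = "\<lambda>\<alpha>. Sigma0 Y (g \<alpha>)" and Y = "topspace Y"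
        and C = "topspace Y" and u = u and A = A] assms
    by (simp add: determined_on_def Sigma0_Int openin_Sigma0)
  then show ?thesis
    by (simp add: level_in_def)
qed

text \<open>The map \<open>g\<close> selects the Borel classes that form the base; the Borel base and all its shifts
  have this form. Two representations with the same values on \<open>X\<close> coincide, because their members
  are extensional functions.\<close>

lemma principal_TR_Sigma0:
  fixes X :: "'x topology" and u :: "'q sterm"
  assumes pos: "\<And>\<alpha>. 0 < g \<alpha>" and amenable: "\<And>\<alpha>. amenable X (Sigma0 (baire_times X) (g \<alpha>))"
  shows "\<exists>\<nu>. is_principal_TR (level_in (topspace X) (\<lambda>\<alpha>. Sigma0 X (g \<alpha>)) u)
    (level_in (topspace (baire_times X)) (\<lambda>\<alpha>. Sigma0 (baire_times X) (g \<alpha>)) u) \<nu>"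
proof -
  let ?Z = "topspace (baire_times X)"
  let ?L = "\<lambda>\<alpha>. Sigma0 X (g \<alpha>)" and ?M = "\<lambda>\<alpha>. Sigma0 (baire_times X) (g \<alpha>)"
  obtain H where H: "parametrizes X (in_level u ?M) H"
    using exists_parametrization[of X ?M u, OF amenable] by blast
  define \<nu> where "\<nu> = (\<lambda>a. restrict (\<lambda>x. H (a, x)) (topspace X))"
  have H_in: "in_level u ?M ?Z H"
    using H by (simp add: parametrizes_def)
  have "\<nu> a \<in> level_in (topspace X) ?L u" for a
  proof -
    have cont: "continuous_map X (baire_times X) (\<lambda>x. (a, x))"
      by (simp add: continuous_map_pairwise comp_def)
    have "in_level u ?L (topspace X) (\<nu> a)"
      by (rule in_level_preimage[OF Sigma0_preimage[OF cont] H_in]) (auto simp: \<nu>_def)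
    then show ?thesis
      unfolding level_in_Sigma0[of g, OF pos] by (simp add: \<nu>_def)
  qed
  moreover have "(\<lambda>(a, x). \<nu> a x) \<in> level_in ?Z ?M u"
  proof -
    have "in_level u ?M ?Z (\<lambda>(a, x). \<nu> a x)"
    proof (rule in_level_preimage[OF _ H_in, where h = id and Y = ?Z])
      show "id -` S \<inter> ?Z \<in> ?M \<alpha>" if "S \<in> ?M \<alpha>" for \<alpha> S
        using that Sigma0_subset_topspace[OF that] by (simp add: Int_absorb2 del: topspace_prod_topology)
    qed (auto simp: \<nu>_def)
    then show ?thesis
      unfolding level_in_Sigma0[of g, OF pos] by (auto simp: \<nu>_def extensional_def)
  qed
  moreover have "\<exists>f. continuous_map baire_space baire_space f \<and> \<mu> = \<nu> \<circ> f"
    if \<mu>: "is_TR (level_in (topspace X) ?L u) (level_in ?Z ?M u) \<mu>" for \<mu>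
  proof -
    have extensional: "\<mu> a \<in> extensional (topspace X)" for a
      using \<mu> unfolding is_TR_def level_in_Sigma0[of g, OF pos] by blast
    have "in_level u ?M ?Z (\<lambda>(a, x). \<mu> a x)"
      using \<mu> unfolding is_TR_def level_in_Sigma0[of g, OF pos] by blast
    then obtain f where f: "continuous_map baire_space baire_space f"
        "\<And>z. z \<in> ?Z \<Longrightarrow> (case z of (a, x) \<Rightarrow> \<mu> a x) = H (reparam f z)"
      by (rule parametrizes_obtain[OF H order_refl]) (rule that)
    have "\<mu> a x = \<nu> (f a) x" for a x
      using f(2)[of "(a, x) "] extensional[of a] by (cases "x \<in> topspace X") (auto simp: \<nu>_def extensional_def)
    then have "\<mu> = \<nu> \<circ> f"
      by (intro ext) simp
    then show ?thesis
      using f(1) by blast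
  qed
  ultimately show ?thesis
    unfolding is_principal_TR_def is_TR_def by blast
qed

lemma amenable_Sigma0:
  assumes "enumerates_base X B" "0 < \<alpha>" "1 < \<alpha> \<or> zero_dimensional X"
  shows "amenable X (Sigma0 (baire_times X) \<alpha>)"
proof -
  have "has_reduction (Sigma0 (baire_times X) \<alpha>)"
  proof (cases "1 < \<alpha>")
    case True
    then show ?thesis
      by (rule Sigma0_has_reduction)
  next
    case False
    then have "\<alpha> = 1"
      using assms(2) one_le_iff_omega1[of \<alpha>] by simp
    then show ?thesis
      using open_has_reduction_zero_dimensional[OF assms(1)] assms(3) False by simp
  qed
  then show ?thesis
    unfolding amenable_def
    by (intro conjI allI impI universal_set_Sigma0[OF assms(1,2)]
        Sigma0_preimage[OF continuous_map_reparam])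
qed

theorem theorem2:
  fixes X :: "'x topology"
  assumes "second_countable X" and "t0_space X"
  shows "(\<forall>u :: ('q :: preorder) sterm.
            \<exists>\<nu>. is_principal_TR (level1 X u) (level1 (prod_topology baire_space X) u) \<nu>) \<and>
         (zero_dimensional X \<longrightarrow>
           (\<forall>u :: 'q sterm.
              \<exists>\<nu>. is_principal_TR (level X u) (level (prod_topology baire_space X) u) \<nu>))"
proof -
  obtain B where B: "enumerates_base X B"
    using second_countable_enumerates_base[OF assms(1)] by blast
  have pos: "0 < oadd 1 \<alpha>" for \<alpha>
    using oadd_bounds(1)[of 1 \<alpha>] one_le_iff_omega1 by simp
  \<comment> \<open>the shifted Borel base only contains classes from \<open>\<Sigma>\<^sup>0\<^sub>2\<close> on\<close>
  have above: "1 < oadd 1 (oadd 1 \<alpha>)" for \<alpha>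
    using le_less_trans[OF oadd_bounds(1)[of 1 0] oadd_bounds(2)[OF pos]] .
  show ?thesis
  proof (intro conjI allI impI)
    fix u :: "'q sterm"
    have "amenable X (Sigma0 (baire_times X) (oadd 1 (oadd 1 \<alpha>)))" for \<alpha>
      by (rule amenable_Sigma0[OF B pos]) (simp add: above)
    from principal_TR_Sigma0[OF pos this]
    show "\<exists>\<nu>. is_principal_TR (level1 X u) (level1 (baire_times X) u) \<nu>"
      unfolding level1_def shift_base_def borel_base_def .
  next
    fix u :: "'q sterm"
    assume "zero_dimensional X"
    then have "amenable X (Sigma0 (baire_times X) (oadd 1 \<alpha>))" for \<alpha>
      by (intro amenable_Sigma0[OF B pos]) simp
    from principal_TR_Sigma0[OF pos this]
    show "\<exists>\<nu>. is_principal_TR (level X u) (level (baire_times X) u) \<nu>"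
      unfolding level_def borel_base_def .
  qed
qed

end
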